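(* Let $F$ be an infinite field with $\operatorname{char}F\ne2$, and let $I$ be the $T_{\mathbb{Z}_3}$-ideal of $\mathbb{Z}_3$-graded identities of $UT_3(F)^{(-)}$ with its canonical grading. Then every $T_{\mathbb{Z}_3}$-ideal $J$ with $I\subseteq J$ is finitely generated as a $T_{\mathbb{Z}_3}$-ideal.
   Context: $UT_3(F)^{(-)}$ is the Lie algebra of $3\times3$ upper triangular matrices with bracket $[a,b]=ab-ba$, with canonical $\mathbb{Z}_3$-grading (degree-$k$ component spanned by $e_{ij}$ with $j-i=k$). The free Lie algebra is generated by countably many variables $y_i$ of degree $0$, $z_i$ of degree $1$, $w_i$ of degree $2$, with the induced grading. A $T_{\mathbb{Z}_3}$-ideal is a graded ideal invariant under degree-preserving endomorphisms; $I$ consists of all polynomials vanishing on $UT_3(F)^{(-)}$ under degree-respecting substitutions. *)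

theory Defs
  imports Main
begin

datatype var = Y nat | Z nat | W nat

fun vdeg :: "var \<Rightarrow> nat" where
  "vdeg (Y _) = 0" | "vdeg (Z _) = 1" | "vdeg (W _) = 2"

definition wdeg :: "var list \<Rightarrow> nat" where
  "wdeg w = sum_list (map vdeg w) mod 3"

text \<open>Elements of the free associative algebra F<X>: coefficient functions on words.\<close>
type_synonym 'a fpoly = "var list \<Rightarrow> 'a"

definition pvar :: "var \<Rightarrow> 'a::field fpoly" where
  "pvar x = (\<lambda>w. if w = [x] then 1 else 0)"

definition pone :: "'a::field fpoly" where
  "pone = (\<lambda>w. if w = [] then 1 else 0)"

definition padd :: "'a::field fpoly \<Rightarrow> 'a fpoly \<Rightarrow> 'a fpoly" where
  "padd f g = (\<lambda>w. f w + g w)"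

definition psmult :: "'a::field \<Rightarrow> 'a fpoly \<Rightarrow> 'a fpoly" where
  "psmult c f = (\<lambda>w. c * f w)"

definition pmul :: "'a::field fpoly \<Rightarrow> 'a fpoly \<Rightarrow> 'a fpoly" where
  "pmul f g = (\<lambda>w. \<Sum>i\<le>length w. f (take i w) * g (drop i w))"

definition pbr :: "'a::field fpoly \<Rightarrow> 'a fpoly \<Rightarrow> 'a fpoly" where
  "pbr f g = (\<lambda>w. pmul f g w - pmul g f w)"

text \<open>The free Lie algebra L(X) = Lie subalgebra of F<X> generated by the variables.\<close>
inductive_set lie_polys :: "'a::field fpoly set" where
  var: "pvar x \<in> lie_polys"
| zero: "(\<lambda>_. 0) \<in> lie_polys"
| add: "f \<in> lie_polys \<Longrightarrow> g \<in> lie_polys \<Longrightarrow> padd f g \<in> lie_polys"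
| smult: "f \<in> lie_polys \<Longrightarrow> psmult c f \<in> lie_polys"
| br: "f \<in> lie_polys \<Longrightarrow> g \<in> lie_polys \<Longrightarrow> pbr f g \<in> lie_polys"

definition hcomp :: "nat \<Rightarrow> 'a::field fpoly \<Rightarrow> 'a fpoly" where
  "hcomp k f = (\<lambda>w. if wdeg w = k then f w else 0)"

fun wprod :: "(var \<Rightarrow> 'a::field fpoly) \<Rightarrow> var list \<Rightarrow> 'a fpoly" where
  "wprod \<sigma> [] = pone"
| "wprod \<sigma> (x # w) = pmul (\<sigma> x) (wprod \<sigma> w)"

text \<open>Substitution endomorphism x \<mapsto> sigma x (f has finite support).\<close>
definition subst :: "(var \<Rightarrow> 'a::field fpoly) \<Rightarrow> 'a fpoly \<Rightarrow> 'a fpoly" where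
  "subst \<sigma> f = (\<lambda>u. \<Sum>w\<in>{w. f w \<noteq> 0}. f w * wprod \<sigma> w u)"

text \<open>Degree-preserving endomorphisms of L(X) are exactly given by graded substitutions.\<close>
definition graded_subst :: "(var \<Rightarrow> 'a::field fpoly) \<Rightarrow> bool" where
  "graded_subst \<sigma> \<longleftrightarrow> (\<forall>x. \<sigma> x \<in> lie_polys \<and> hcomp (vdeg x) (\<sigma> x) = \<sigma> x)"

definition is_TZ3_ideal :: "'a::field fpoly set \<Rightarrow> bool" where
  "is_TZ3_ideal J \<longleftrightarrow>
     J \<subseteq> lie_polys \<and> (\<lambda>_. 0) \<in> J
   \<and> (\<forall>f\<in>J. \<forall>g\<in>J. padd f g \<in> J)
   \<and> (\<forall>f\<in>J. \<forall>c. psmult c f \<in> J)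
   \<and> (\<forall>f\<in>J. \<forall>g\<in>lie_polys. pbr f g \<in> J)
   \<and> (\<forall>f\<in>J. \<forall>k<3. hcomp k f \<in> J)
   \<and> (\<forall>f\<in>J. \<forall>\<sigma>. graded_subst \<sigma> \<longrightarrow> subst \<sigma> f \<in> J)"

definition TZ3_generated :: "'a::field fpoly set \<Rightarrow> 'a fpoly set" where
  "TZ3_generated S = \<Inter>{K. is_TZ3_ideal K \<and> S \<subseteq> K}"

text \<open>3x3 matrices as functions on indices 0,1,2 (entries outside are zero).\<close>
type_synonym 'a mat3 = "nat \<Rightarrow> nat \<Rightarrow> 'a"

definition mmul :: "'a::field mat3 \<Rightarrow> 'a mat3 \<Rightarrow> 'a mat3" where
  "mmul A B = (\<lambda>i j. \<Sum>k<3. A i k * B k j)"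

definition mone :: "'a::field mat3" where
  "mone = (\<lambda>i j. if i = j \<and> i < 3 then 1 else 0)"

definition UTdeg :: "nat \<Rightarrow> 'a::field mat3 \<Rightarrow> bool" where
  "UTdeg k A \<longleftrightarrow> (\<forall>i j. A i j \<noteq> 0 \<longrightarrow> i < 3 \<and> j < 3 \<and> j = i + k)"

fun mword :: "(var \<Rightarrow> 'a::field mat3) \<Rightarrow> var list \<Rightarrow> 'a mat3" where
  "mword \<phi> [] = mone"
| "mword \<phi> (x # w) = mmul (\<phi> x) (mword \<phi> w)"

text \<open>Evaluation; for Lie polynomials this equals evaluation with bracket ab - ba.\<close>
definition meval :: "(var \<Rightarrow> 'a::field mat3) \<Rightarrow> 'a fpoly \<Rightarrow> 'a mat3" where
  "meval \<phi> f = (\<lambda>i j. \<Sum>w\<in>{w. f w \<noteq> 0}. f w * mword \<phi> w i j)"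

definition UT3_graded_ids :: "'a::field fpoly set" where
  "UT3_graded_ids = {f \<in> lie_polys. \<forall>\<phi>. (\<forall>x. UTdeg (vdeg x) (\<phi> x)) \<longrightarrow> meval \<phi> f = (\<lambda>_ _. 0)}"

end

theory Submission
  imports Defs "HOL-Library.Multiset_Order" "HOL-Library.Sublist" "HOL-Library.Ramsey"
    "HOL-Library.Function_Algebras" "HOL.Vector_Spaces"
begin

text \<open>Modulo the three identities \<open>[y\<^sub>1, y\<^sub>2] = [z, w] = [w\<^sub>1, w\<^sub>2] = 0\<close> the free Lie algebra is spanned by the
  \<open>y\<^sub>i\<close>, the \<open>[z\<^sub>k, y, \<dots>, y]\<close>, the \<open>[w\<^sub>k, y, \<dots>, y]\<close> and the \<open>[[z\<^sub>k, y, \<dots>, y], [z\<^sub>l, y, \<dots>, y]]\<close>, where the order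
  of the \<open>y\<close>'s is irrelevant. Substituting 0 for variables and taking homogeneous components splits an
  element of \<open>J\<close> into parts involving one \<open>z\<^sub>k\<close>, one \<open>w\<^sub>k\<close> or one pair \<open>z\<^sub>k, z\<^sub>l\<close>; for \<open>k = l\<close> linearization
  reduces to \<open>k \<noteq> l\<close>, as 2 is invertible. Such parts are polynomials in commuting variables
  \<open>u\<^sub>i, v\<^sub>i\<close> (the action of \<open>y\<^sub>i\<close> on the first and on the second \<open>z\<close>), and substitutions
  \<open>z \<mapsto> [z, y\<^sub>i]\<close> and \<open>y\<^sub>i \<mapsto> y\<^bsub>\<pi> i\<^esub>\<close> make those lying in \<open>J\<close> an ideal stable under increasing relabellings
  of the indices. By Cohen's theorem, a Groebner argument on top of Higman's lemma, such an ideal is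
  finitely generated up to relabelling.\<close>

section \<open>Higman's lemma and monomials up to relabelling\<close>

definition almost_full :: "('a \<Rightarrow> 'a \<Rightarrow> bool) \<Rightarrow> bool" where
  "almost_full P \<longleftrightarrow> (\<forall>f :: nat \<Rightarrow> 'a. \<exists>i j. i < j \<and> P (f i) (f j))"

text \<open>Ramsey's theorem for pairs coloured by whether \<open>P\<close> holds. The bad colour
  cannot occur on the homogeneous set, since every sequence, also one enumerating that set, has a
  good pair. Ramsey colours unordered pairs; \<open>Min\<close> and \<open>Max\<close> recover their
  order.\<close>

lemma almost_full_subseq:
  fixes f :: "nat \<Rightarrow> 'a"
  assumes "almost_full P"
  obtains \<phi> :: "nat \<Rightarrow> nat" where "strict_mono \<phi>" "\<And>i j. i < j \<Longrightarrow> P (f (\<phi> i)) (f (\<phi> j))"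
proof -
  define col :: "nat set \<Rightarrow> nat" where "col = (\<lambda>S. if P (f (Min S)) (f (Max S)) then 0 else 1)"
  obtain H t where H: "infinite H" "\<And>x y. x \<in> H \<Longrightarrow> y \<in> H \<Longrightarrow> x \<noteq> y \<Longrightarrow> col {x, y} = t"
  proof -
    have "\<exists>Y t. Y \<subseteq> UNIV \<and> infinite Y \<and> t < 2 \<and> (\<forall>x\<in>Y. \<forall>y\<in>Y. x \<noteq> y \<longrightarrow> col {x, y} = t)"
      by (rule Ramsey2) (auto simp: col_def)
    then obtain Y t where "infinite Y" "\<forall>x\<in>Y. \<forall>y\<in>Y. x \<noteq> y \<longrightarrow> col {x, y} = t"
      by (elim exE conjE)
    then show ?thesis by (intro that[of Y t]) simp_all
  qed
  define \<phi> where "\<phi> = enumerate H"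
  have mono: "strict_mono \<phi>"
    unfolding \<phi>_def by (rule strict_mono_enumerate[OF H(1)])
  have col: "col {\<phi> i, \<phi> j} = (if P (f (\<phi> i)) (f (\<phi> j)) then 0 else 1)" if "i < j" for i j
    using strict_monoD[OF mono that] by (simp add: col_def)
  have t: "col {\<phi> i, \<phi> j} = t" if "i < j" for i j
    using strict_monoD[OF mono that] H(1) unfolding \<phi>_def
    by (intro H(2)) (metis enumerate_in_set less_irrefl)+
  obtain a b where ab: "a < b" "P (f (\<phi> a)) (f (\<phi> b))"
    using assms[unfolded almost_full_def, rule_format, of "\<lambda>n. f (\<phi> n)"] by blast
  have "t = 0" using col[OF ab(1)] t[OF ab(1)] ab(2) by simp
  then have "P (f (\<phi> i)) (f (\<phi> j))" if "i < j" for i j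
    using col[OF that] t[OF that] by (simp split: if_splits)
  with mono show ?thesis by (rule that)
qed

text \<open>Dickson's lemma for two exponents: along a subsequence with nondecreasing first
  components, a good pair for the second components is good for both.\<close>

lemma almost_full_nat_pair:
  "almost_full (\<lambda>p q :: nat \<times> nat. fst p \<le> fst q \<and> snd p \<le> snd q)"
proof -
  have nat: "almost_full ((\<le>) :: nat \<Rightarrow> nat \<Rightarrow> bool)"
    unfolding almost_full_def
  proof
    fix f :: "nat \<Rightarrow> nat"
    obtain i where i: "\<And>j. f i \<le> f j"
      using ex_has_least_nat[of "\<lambda>_. True" 0 f] by auto
    then show "\<exists>i j. i < j \<and> f i \<le> f j" by blast
  qed
  show ?thesis
    unfolding almost_full_def
  proof
    fix f :: "nat \<Rightarrow> nat \<times> nat"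
    obtain \<phi> :: "nat \<Rightarrow> nat" where \<phi>: "strict_mono \<phi>"
      "\<And>i j. i < j \<Longrightarrow> fst (f (\<phi> i)) \<le> fst (f (\<phi> j))"
      using almost_full_subseq[OF nat, of "\<lambda>n. fst (f n)"] by blast
    obtain i j where "i < j" "snd (f (\<phi> i)) \<le> snd (f (\<phi> j))"
      using nat[unfolded almost_full_def, rule_format, of "\<lambda>n. snd (f (\<phi> n))"] by blast
    with \<phi> show "\<exists>i j. i < j \<and> fst (f i) \<le> fst (f j) \<and> snd (f i) \<le> snd (f j)"
      by (meson strict_monoD)
  qed
qed

text \<open>Nash-Williams' minimal bad sequence argument.\<close>

theorem almost_full_list_emb:
  assumes af: "almost_full P"
  shows "almost_full (list_emb P)"
proof (rule ccontr)
  define bad where "bad = (\<lambda>s :: nat \<Rightarrow> 'a list. \<forall>i j. i < j \<longrightarrow> \<not> list_emb P (s i) (s j))"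
  define Q where "Q = (\<lambda>n s s'. bad s' \<and> (\<forall>i<n. s' i = s i) \<and>
    (\<forall>s''. bad s'' \<longrightarrow> (\<forall>i<n. s'' i = s i) \<longrightarrow> length (s' n) \<le> length (s'' n)))"
  assume "\<not> almost_full (list_emb P)"
  then obtain s0 where s0: "bad s0" unfolding almost_full_def bad_def by blast
  have ex: "\<exists>s'. Q n s s'" if "bad s" for n s
    using ex_has_least_nat[of "\<lambda>s'. bad s' \<and> (\<forall>i<n. s' i = s i)" s "\<lambda>s'. length (s' n)"] that
    unfolding Q_def by blast
  \<comment> \<open>\<open>S (Suc n)\<close> keeps the first n entries of \<open>S n\<close> and
    makes entry n as short as any bad continuation allows. The diagonal \<open>m\<close> is then a
    minimal bad sequence.\<close>
  obtain S where S: "\<And>n. bad (S n)" "\<And>n. Q n (S n) (S (Suc n))"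
  proof -
    have "\<exists>S. \<forall>n. bad (S n) \<and> Q n (S n) (S (Suc n))"
    proof (rule dependent_nat_choice)
      show "\<exists>s. bad s" using s0 by blast
      show "\<exists>s'. bad s' \<and> Q n s s'" if "bad s" for s n
        using ex[OF that, of n] unfolding Q_def by blast
    qed
    with that show ?thesis by blast
  qed
  define m where "m = (\<lambda>n. S (Suc n) n)"
  have agree: "S k n = m n" if "n < k" for n k
    using that
  proof (induction k)
    case (Suc k)
    show ?case
    proof (cases "n = k")
      case False
      with Suc have "S k n = m n" by simp
      moreover have "S (Suc k) n = S k n" using S(2)[of k] False Suc.prems unfolding Q_def by simp
      ultimately show ?thesis by simp
    qed (simp add: m_def)
  qed simp
  have badm: "bad m"
    unfolding bad_def
  proof (intro allI impI)
    fix i j :: nat assume "i < j"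
    then show "\<not> list_emb P (m i) (m j)"
      using S(1)[of "Suc j"] agree[of i "Suc j"] agree[of j "Suc j"] unfolding bad_def by (metis less_Suc_eq)
  qed
  have min: "length (m n) \<le> length (s n)" if "bad s" "\<And>i. i < n \<Longrightarrow> s i = m i" for s n
    using S(2)[of n] that agree[of _ n] unfolding Q_def by (simp add: m_def)
  have ne: "m n \<noteq> []" for n
    using badm unfolding bad_def by (metis list_emb_Nil lessI)
  define h t where "h = (\<lambda>n. hd (m n))" and "t = (\<lambda>n. tl (m n))"
  have m: "m n = h n # t n" for n using ne[of n] by (simp add: h_def t_def)
  obtain \<phi> :: "nat \<Rightarrow> nat" where \<phi>: "strict_mono \<phi>" "\<And>i j. i < j \<Longrightarrow> P (h (\<phi> i)) (h (\<phi> j))"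
    using almost_full_subseq[OF af, of h] by blast
  \<comment> \<open>From place \<open>\<phi> 0\<close> on, \<open>m\<close> is replaced by the tails
    along \<open>\<phi>\<close>. An embedding between entries of \<open>s\<close> would lift to one
    between entries of \<open>m\<close> by prepending heads, so \<open>s\<close> is bad although it
    is shorter at \<open>\<phi> 0\<close>.\<close>
  define s where "s = (\<lambda>n. if n < \<phi> 0 then m n else t (\<phi> (n - \<phi> 0)))"
  have "bad s"
    unfolding bad_def
  proof (intro allI impI notI)
    fix i j :: nat assume ij: "i < j" and emb: "list_emb P (s i) (s j)"
    consider "j < \<phi> 0" | "i < \<phi> 0" "\<not> j < \<phi> 0" | "\<not> i < \<phi> 0" "\<not> j < \<phi> 0" using ij by linarith
    then show False
    proof cases
      case 1
      then show False using emb ij badm by (simp add: s_def bad_def)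
    next
      case 2
      have "\<phi> 0 \<le> \<phi> (j - \<phi> 0)" using \<phi>(1) by (simp add: strict_mono_less_eq)
      then have "i < \<phi> (j - \<phi> 0)" using 2 by simp
      moreover have "list_emb P (m i) (m (\<phi> (j - \<phi> 0)))"
        using emb 2 m[of "\<phi> (j - \<phi> 0)"] by (simp add: s_def list_emb_Cons)
      ultimately show False using badm unfolding bad_def by blast
    next
      case 3
      have lt: "i - \<phi> 0 < j - \<phi> 0" using 3 ij by simp
      have "list_emb P (m (\<phi> (i - \<phi> 0))) (m (\<phi> (j - \<phi> 0)))"
        using emb 3 \<phi>(2)[OF lt] m[of "\<phi> (i - \<phi> 0)"] m[of "\<phi> (j - \<phi> 0)"]
        by (simp add: s_def list_emb_Cons2)
      then show False using badm strict_monoD[OF \<phi>(1) lt] unfolding bad_def by blast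
    qed
  qed
  then have "length (m (\<phi> 0)) \<le> length (s (\<phi> 0))" by (rule min) (simp add: s_def)
  then show False using m[of "\<phi> 0"] by (simp add: s_def)
qed

text \<open>The embedding of positions is extended to an increasing map on all natural numbers, so
  that it can serve as a relabelling of all indices.\<close>

lemma list_emb_strict_mono:
  assumes "list_emb P xs ys"
  shows "\<exists>\<pi> :: nat \<Rightarrow> nat. strict_mono \<pi> \<and>
    (\<forall>i < length xs. \<pi> i < length ys \<and> P (xs ! i) (ys ! \<pi> i))"
  using assms
proof (induction rule: list_emb.induct)
  case (list_emb_Nil ys)
  show ?case by (rule exI[of _ id]) (simp add: strict_mono_def)
next
  case (list_emb_Cons xs ys y)
  then obtain \<pi> where "strict_mono \<pi>" "\<forall>i < length xs. \<pi> i < length ys \<and> P (xs ! i) (ys ! \<pi> i)"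
    by blast
  then show ?case by (intro exI[of _ "\<lambda>i. Suc (\<pi> i)"]) (simp add: strict_mono_def)
next
  case (list_emb_Cons2 x y xs ys)
  then obtain \<pi> where "strict_mono \<pi>" "\<forall>i < length xs. \<pi> i < length ys \<and> P (xs ! i) (ys ! \<pi> i)"
    by blast
  then show ?case using \<open>P x y\<close>
    by (intro exI[of _ "\<lambda>i. case i of 0 \<Rightarrow> 0 | Suc k \<Rightarrow> Suc (\<pi> k)"])
      (auto simp: strict_mono_def less_Suc_eq_0_disj split: nat.splits)
qed

lemma almost_full_finite_basis:
  assumes "almost_full R"
  shows "\<exists>B. finite B \<and> B \<subseteq> Q \<and> (\<forall>q\<in>Q. \<exists>p\<in>B. R p q)"
proof (rule ccontr)
  assume "\<not> ?thesis"
  then have no: "\<exists>x\<in>Q. \<forall>p\<in>B. \<not> R p x" if "finite B" "B \<subseteq> Q" for B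
    using that by (simp only: not_ex de_Morgan_conj simp_thms bex_simps ball_simps) auto
  \<comment> \<open>Greedy choice: \<open>A n\<close> collects the elements chosen so far, and each
    new element lies above none of them. The chosen elements form a sequence without a good
    pair.\<close>
  have "\<exists>A. \<forall>n. (finite (A n) \<and> A n \<subseteq> Q) \<and> (\<exists>x\<in>Q. (\<forall>p\<in>A n. \<not> R p x) \<and> A (Suc n) = insert x (A n))"
  proof (rule dependent_nat_choice)
    show "\<exists>B. finite B \<and> B \<subseteq> Q" by blast
    fix B :: "'a set" and n :: nat
    assume "finite B \<and> B \<subseteq> Q"
    then show "\<exists>C. (finite C \<and> C \<subseteq> Q) \<and> (\<exists>x\<in>Q. (\<forall>p\<in>B. \<not> R p x) \<and> C = insert x B)"
      using no[of B] by blast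
  qed
  then obtain A where
    "\<forall>n. (finite (A n) \<and> A n \<subseteq> Q) \<and> (\<exists>x\<in>Q. (\<forall>p\<in>A n. \<not> R p x) \<and> A (Suc n) = insert x (A n))" ..
  then have "\<forall>n. \<exists>x. (\<forall>p\<in>A n. \<not> R p x) \<and> A (Suc n) = insert x (A n)"
    by (simp add: Bex_def) metis
  then obtain x where A: "\<And>n. \<forall>p\<in>A n. \<not> R p (x n)" "\<And>n. A (Suc n) = insert (x n) (A n)"
    using choice[of "\<lambda>n x. (\<forall>p\<in>A n. \<not> R p x) \<and> A (Suc n) = insert x (A n)"] by blast
  have sub: "x i \<in> A j" if "i < j" for i j
    using that by (induction j) (auto simp: A(2) less_Suc_eq)
  show False
    using assms[unfolded almost_full_def, rule_format, of x] A(1) sub by blast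
qed

text \<open>A multiset over \<^typ>\<open>nat\<close> encodes a monomial in the variables \<open>u\<^sub>i, v\<^sub>i\<close>: the element
  \<open>2 * i\<close> stands for \<open>u\<^sub>i\<close> and \<open>2 * i + 1\<close> for \<open>v\<^sub>i\<close>. The multiset order on these monomials is a
  well-order compatible with products and with strictly increasing relabellings of the indices.\<close>

definition block_map :: "(nat \<Rightarrow> nat) \<Rightarrow> nat \<Rightarrow> nat" where
  "block_map \<pi> c = 2 * \<pi> (c div 2) + c mod 2"

lemma strict_mono_block_map:
  assumes "strict_mono \<pi>"
  shows "strict_mono (block_map \<pi>)"
proof (rule strict_monoI)
  fix a b :: nat assume "a < b"
  then consider "a div 2 < b div 2" | "a div 2 = b div 2" "a mod 2 < b mod 2"
    by (metis div_le_mono less_imp_le_nat mult_div_mod_eq nat_add_left_cancel_less nat_less_le)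
  then show "block_map \<pi> a < block_map \<pi> b"
  proof cases
    case 1
    then show ?thesis using strict_monoD[OF assms 1] unfolding block_map_def by linarith
  qed (simp add: block_map_def)
qed

text \<open>In the Dershowitz-Manna form of the multiset order, \<open>M\<close> arises from
  \<open>N\<close> by trading \<open>X\<close> for dominated elements \<open>Y\<close>; an
  increasing map carries this trade over.\<close>

lemma less_image_mset_strict_mono:
  fixes f :: "'a::linorder \<Rightarrow> 'b::linorder"
  assumes "strict_mono f" "M < N"
  shows "image_mset f M < image_mset f N"
proof -
  obtain X Y where XY: "X \<noteq> {#}" "X \<subseteq># N" "M = (N - X) + Y" "\<forall>k. k \<in># Y \<longrightarrow> (\<exists>a. a \<in># X \<and> k < a)"
    using assms(2) unfolding less_multiset\<^sub>D\<^sub>M by blast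
  have "image_mset f X \<noteq> {#}" "image_mset f X \<subseteq># image_mset f N"
    "image_mset f M = (image_mset f N - image_mset f X) + image_mset f Y"
    using XY(1-3) by (simp_all add: image_mset_subseteq_mono image_mset_Diff del: subset_mset.add_diff_assoc2)
  moreover have "\<forall>k. k \<in># image_mset f Y \<longrightarrow> (\<exists>a. a \<in># image_mset f X \<and> k < a)"
    using XY(4) strict_monoD[OF assms(1)] by fastforce
  ultimately show ?thesis unfolding less_multiset\<^sub>D\<^sub>M by blast
qed

text \<open>Divisibility of monomials after an increasing relabelling of the indices.\<close>

definition shift_dvd :: "nat multiset \<Rightarrow> nat multiset \<Rightarrow> bool" where
  "shift_dvd M N \<longleftrightarrow> (\<exists>\<pi>. strict_mono \<pi> \<and> image_mset (block_map \<pi>) M \<subseteq># N)"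

lemma almost_full_shift_dvd: "almost_full shift_dvd"
  unfolding almost_full_def
proof
  fix f :: "nat \<Rightarrow> nat multiset"
  define P where "P = (\<lambda>p q :: nat \<times> nat. fst p \<le> fst q \<and> snd p \<le> snd q)"
  \<comment> \<open>The list of exponent pairs of u_i and v_i, to which Higman's lemma applies.
    Every element of \<open>M\<close> is at most \<open>sum_mset M\<close>, so the list is long
    enough to record all exponents.\<close>
  define ex where "ex = (\<lambda>M :: nat multiset.
    map (\<lambda>i. (count M (2 * i), count M (2 * i + 1))) [0..<Suc (sum_mset M)])"
  have "almost_full (list_emb P)"
    unfolding P_def by (intro almost_full_list_emb almost_full_nat_pair)
  then obtain i j where ij: "i < j" "list_emb P (ex (f i)) (ex (f j))"
    unfolding almost_full_def by (metis comp_apply)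
  obtain \<pi> where \<pi>: "strict_mono \<pi>"
    "\<And>k. k < Suc (sum_mset (f i)) \<Longrightarrow> \<pi> k < Suc (sum_mset (f j)) \<and> P (ex (f i) ! k) (ex (f j) ! \<pi> k)"
    using list_emb_strict_mono[OF ij(2)] by (auto simp: ex_def)
  have cnt: "count (f i) c \<le> count (f j) (block_map \<pi> c)" if "c \<in># f i" for c
  proof -
    have "c \<le> sum_mset (f i)" using that by (metis multi_member_split sum_mset.add_mset le_add1)
    then have k: "c div 2 < Suc (sum_mset (f i))" by linarith
    have nth: "ex M ! k = (count M (2 * k), count M (2 * k + 1))" if "k < Suc (sum_mset M)" for M k
      unfolding ex_def using nth_map_upt[of k "Suc (sum_mset M)" 0] that by simp
    have "count (f i) (2 * (c div 2)) \<le> count (f j) (2 * \<pi> (c div 2))"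
      "count (f i) (2 * (c div 2) + 1) \<le> count (f j) (2 * \<pi> (c div 2) + 1)"
      using \<pi>(2)[OF k] nth[OF k] nth[of "\<pi> (c div 2)" "f j"] by (simp_all add: P_def)
    moreover have "c = 2 * (c div 2) + c mod 2" by simp
    moreover have "c mod 2 = 0 \<or> c mod 2 = 1" by linarith
    ultimately show ?thesis unfolding block_map_def by (metis add_0_right)
  qed
  have inj: "inj (block_map \<pi>)" using strict_mono_block_map[OF \<pi>(1)] by (rule strict_mono_imp_inj_on)
  have cnt_image: "count (image_mset (block_map \<pi>) M) (block_map \<pi> c) = count M c" for M c
    using inj by (induction M) (auto simp: inj_eq)
  have "image_mset (block_map \<pi>) (f i) \<subseteq># f j"
    unfolding subseteq_mset_def
  proof
    fix d
    show "count (image_mset (block_map \<pi>) (f i)) d \<le> count (f j) d"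
    proof (cases "d \<in># image_mset (block_map \<pi>) (f i)")
      case True
      then obtain c where c: "c \<in># f i" "d = block_map \<pi> c" by auto
      then show ?thesis using cnt[OF c(1)] cnt_image by simp
    qed (metis not_in_iff zero_le)
  qed
  with \<pi>(1) ij(1) show "\<exists>i j. i < j \<and> shift_dvd (f i) (f j)" unfolding shift_dvd_def by blast
qed

section \<open>The free associative and the free Lie algebra\<close>

text \<open>Induction rules \<open>\<eta>\<close>-expand polynomials; the pointwise rules would then turn \<open>f + g\<close> into a
  \<open>\<lambda>\<close>-term to which no closure property applies.\<close>

lemmas [simp del] = plus_fun_apply zero_fun_apply minus_apply uminus_apply

lemmas fpoly_eq_iff = fun_eq_iff plus_fun_apply zero_fun_apply minus_apply uminus_apply

lemma padd_conv: "padd f g = f + g"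
  by (simp add: padd_def fpoly_eq_iff)

lemma pbr_conv: "pbr f g = pmul f g - pmul g f"
  by (simp add: pbr_def fpoly_eq_iff)

lemma const_zero_conv: "(\<lambda>_. 0) = (0 :: 'b \<Rightarrow> 'a::zero)"
  by (simp add: fpoly_eq_iff)

interpretation fp: vector_space "psmult :: 'a::field \<Rightarrow> 'a fpoly \<Rightarrow> 'a fpoly"
  by unfold_locales (simp_all add: psmult_def fpoly_eq_iff algebra_simps)

section \<open>Polynomials of finite support and the associative product\<close>

definition mon :: "var list \<Rightarrow> 'a::field fpoly" where
  "mon w = (\<lambda>v. if v = w then 1 else 0)"

definition fin_supp :: "'a::field fpoly set" where
  "fin_supp = {f. finite {w. f w \<noteq> 0}}"

lemma pvar_conv: "pvar x = mon [x]"
  by (simp add: pvar_def mon_def)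

lemma pone_conv: "pone = mon []"
  by (simp add: pone_def mon_def)

lemma mon_fin_supp: "mon w \<in> fin_supp"
  by (simp add: mon_def fin_supp_def)

lemma subspace_fin_supp: "fp.subspace (fin_supp :: 'a::field fpoly set)"
proof (rule fp.subspaceI)
  show "0 \<in> (fin_supp :: 'a fpoly set)" by (simp add: fin_supp_def fpoly_eq_iff)
  show "f + g \<in> fin_supp" if "f \<in> fin_supp" "g \<in> fin_supp" for f g :: "'a fpoly"
  proof -
    have "{w. (f + g) w \<noteq> 0} \<subseteq> {w. f w \<noteq> 0} \<union> {w. g w \<noteq> 0}" by (auto simp: plus_fun_apply)
    then show ?thesis using that unfolding fin_supp_def by (auto intro: finite_subset)
  qed
  show "psmult c f \<in> fin_supp" if "f \<in> fin_supp" for c and f :: "'a fpoly"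
  proof -
    have "{w. psmult c f w \<noteq> 0} \<subseteq> {w. f w \<noteq> 0}" by (auto simp: psmult_def)
    then show ?thesis using that unfolding fin_supp_def by (auto intro: finite_subset)
  qed
qed

lemmas fin_supp_closed =
  fp.subspace_0[OF subspace_fin_supp] fp.subspace_add[OF subspace_fin_supp]
  fp.subspace_diff[OF subspace_fin_supp] fp.subspace_scale[OF subspace_fin_supp]
  fp.subspace_neg[OF subspace_fin_supp]

text \<open>Peels off one word at a time, so that multilinear identities need only be checked on
  words.\<close>

lemma fin_supp_induct [consumes 1, case_names zero add]:
  fixes f :: "'a::field fpoly"
  assumes "f \<in> fin_supp" "P 0"
    and step: "\<And>c w f. f \<in> fin_supp \<Longrightarrow> P f \<Longrightarrow> P (psmult c (mon w) + f)"
  shows "P f"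
proof -
  have "finite {w. f w \<noteq> 0}" using assms(1) by (simp add: fin_supp_def)
  then show ?thesis
  proof (induction "{w. f w \<noteq> 0}" arbitrary: f rule: finite_induct)
    case empty
    then have "f = 0" by (auto simp: fpoly_eq_iff)
    then show ?case using assms(2) by simp
  next
    case (insert v V)
    define g where "g = f(v := 0)"
    have V: "V = {w. g w \<noteq> 0}" using insert(2,4) by (auto simp: g_def)
    have "P g" by (rule insert(3)[OF V])
    moreover have "g \<in> fin_supp" using insert(1) V by (simp add: fin_supp_def)
    moreover have "f = psmult (f v) (mon v) + g"
      by (auto simp: fpoly_eq_iff psmult_def mon_def g_def)
    ultimately show ?case using step by metis
  qed
qed

lemma pmul_linear:
  "pmul (f + g) h = pmul f h + pmul g h" "pmul h (f + g) = pmul h f + pmul h g"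
  "pmul (psmult c f) h = psmult c (pmul f h)" "pmul h (psmult c f) = psmult c (pmul h f)"
  "pmul 0 h = 0" "pmul h 0 = 0"
  by (simp_all add: pmul_def psmult_def fpoly_eq_iff sum.distrib sum_distrib_left algebra_simps)

lemma pmul_diff:
  "pmul (f - g) h = pmul f h - pmul g h" "pmul h (f - g) = pmul h f - pmul h g"
  by (simp_all add: pmul_def fpoly_eq_iff sum_subtractf algebra_simps)

lemma pmul_mon: "pmul (mon u) (mon v) = mon (u @ v)"
proof
  fix w
  \<comment> \<open>Only the cut after \<open>length u\<close> letters can contribute.\<close>
  have "pmul (mon u) (mon v) w =
      (\<Sum>i\<le>length w. if i = length u \<and> w = u @ v then 1 else 0 :: 'a)"
    unfolding pmul_def
  proof (rule sum.cong[OF refl])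
    fix i assume "i \<in> {..length w}"
    then have "take i w = u \<and> drop i w = v \<longleftrightarrow> i = length u \<and> w = u @ v"
      by (auto simp: append_eq_conv_conj)
    then show "mon u (take i w) * mon v (drop i w) =
        (if i = length u \<and> w = u @ v then 1 else 0 :: 'a)"
      by (auto simp: mon_def)
  qed
  also have "\<dots> = (if w = u @ v then 1 else 0)" by (cases "w = u @ v") auto
  finally show "pmul (mon u) (mon v) w = (mon (u @ v) :: 'a fpoly) w" by (simp add: mon_def)
qed

lemma pmul_fin_supp:
  assumes "f \<in> fin_supp" "g \<in> fin_supp"
  shows "pmul f g \<in> fin_supp"
  using assms(1)
proof (induction rule: fin_supp_induct)
  case (add c w f)
  have "pmul (mon w) g \<in> fin_supp"
    using assms(2) by (induction rule: fin_supp_induct)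
      (auto simp: pmul_linear pmul_mon mon_fin_supp fin_supp_closed)
  with add show ?case by (simp add: pmul_linear fin_supp_closed)
qed (simp add: pmul_linear fin_supp_closed)

text \<open>Linearity in one argument after the other reduces the claim to concatenation of
  words.\<close>

lemma pmul_assoc:
  fixes f :: "'a::field fpoly"
  assumes "f \<in> fin_supp" "g \<in> fin_supp" "h \<in> fin_supp"
  shows "pmul (pmul f g) h = pmul f (pmul g h)"
proof -
  have 1: "pmul (pmul (mon u) (mon v)) h = pmul (mon u) (pmul (mon v) h)"
    if "h \<in> fin_supp" for u v and h :: "'a fpoly"
    using that by (induction rule: fin_supp_induct) (simp_all add: pmul_linear pmul_mon)
  have 2: "pmul (pmul (mon u) g) h = pmul (mon u) (pmul g h)"
    if "g \<in> fin_supp" for u and g :: "'a fpoly"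
    using that by (induction rule: fin_supp_induct) (simp_all add: pmul_linear 1[OF assms(3)])
  show ?thesis
    using assms(1) by (induction rule: fin_supp_induct) (simp_all add: pmul_linear 2[OF assms(2)])
qed

lemma pbr_linear:
  "pbr (f + g) h = pbr f h + pbr g h" "pbr h (f + g) = pbr h f + pbr h g"
  "pbr (psmult c f) h = psmult c (pbr f h)" "pbr h (psmult c f) = psmult c (pbr h f)"
  "pbr 0 h = 0" "pbr h 0 = 0"
  "pbr (f - g) h = pbr f h - pbr g h" "pbr h (f - g) = pbr h f - pbr h g"
  by (simp_all add: pbr_conv pmul_linear pmul_diff fp.scale_right_diff_distrib algebra_simps)

lemma pbr_anticomm: "pbr g f = - pbr f g"
  by (simp add: pbr_conv)

text \<open>The Jacobi identity in the form that bracketing with \<open>h\<close> on the right is a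
  derivation.\<close>

lemma pbr_jacobi:
  assumes "f \<in> fin_supp" "g \<in> fin_supp" "h \<in> fin_supp"
  shows "pbr (pbr f g) h = pbr (pbr f h) g + pbr f (pbr g h)"
  by (simp add: pbr_conv pmul_diff pmul_assoc assms)

section \<open>Substitution endomorphisms\<close>

lemma subst_superset:
  assumes "finite S" "{w. f w \<noteq> 0} \<subseteq> S"
  shows "subst \<sigma> f = (\<lambda>u. \<Sum>w\<in>S. f w * wprod \<sigma> w u)"
  unfolding subst_def by (rule ext, rule sum.mono_neutral_left) (use assms in auto)

lemma subst_linear:
  assumes "f \<in> fin_supp"
  shows subst_add: "g \<in> fin_supp \<Longrightarrow> subst \<sigma> (f + g) = subst \<sigma> f + subst \<sigma> g"
    and subst_psmult: "subst \<sigma> (psmult c f) = psmult c (subst \<sigma> f)"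
proof -
  show "subst \<sigma> (psmult c f) = psmult c (subst \<sigma> f)"
    using assms subst_superset[of "{w. f w \<noteq> 0}" f] subst_superset[of "{w. f w \<noteq> 0}" "psmult c f"]
    by (auto simp: fin_supp_def psmult_def fpoly_eq_iff sum_distrib_left mult.assoc)
  assume g: "g \<in> fin_supp"
  \<comment> \<open>\<open>subst\<close> sums over the support of its argument; a common finite
    index set makes the three sums comparable.\<close>
  define S where "S = {w. f w \<noteq> 0} \<union> {w. g w \<noteq> 0}"
  have "finite S" using assms g by (simp add: S_def fin_supp_def)
  then show "subst \<sigma> (f + g) = subst \<sigma> f + subst \<sigma> g"
    using subst_superset[of S f] subst_superset[of S g] subst_superset[of S "f + g"]
    by (simp add: S_def subset_iff fpoly_eq_iff sum.distrib distrib_right) (metis add_0_left)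
qed

lemma subst_zero: "subst \<sigma> 0 = 0"
  by (simp add: subst_def fpoly_eq_iff)

lemma subst_diff:
  assumes "f \<in> fin_supp" "g \<in> fin_supp"
  shows "subst \<sigma> (f - g) = subst \<sigma> f - subst \<sigma> g"
proof -
  have "subst \<sigma> f = subst \<sigma> (f - g) + subst \<sigma> g"
    using assms by (subst subst_add[symmetric]) (simp_all add: fin_supp_closed)
  then show ?thesis by simp
qed

lemma subst_mon: "subst \<sigma> (mon w) = wprod \<sigma> w"
  by (subst subst_superset[of "{w}"]) (auto simp: mon_def)

lemma pmul_pone:
  assumes "f \<in> fin_supp"
  shows "pmul f pone = f" "pmul pone f = f"
  using assms by (induction rule: fin_supp_induct)
    (simp_all add: pone_conv pmul_linear pmul_mon)

context
  fixes \<sigma> :: "var \<Rightarrow> 'a::field fpoly"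
  assumes \<sigma>: "\<And>x. \<sigma> x \<in> fin_supp"
begin

lemma wprod_fin_supp: "wprod \<sigma> w \<in> fin_supp"
  by (induction w) (simp_all add: pone_conv mon_fin_supp pmul_fin_supp \<sigma>)

lemma wprod_append: "wprod \<sigma> (u @ v) = pmul (wprod \<sigma> u) (wprod \<sigma> v)"
  by (induction u) (simp_all add: pmul_pone wprod_fin_supp pmul_assoc \<sigma>)

lemma subst_pvar: "subst \<sigma> (pvar x) = \<sigma> x"
  by (simp add: pvar_conv subst_mon pmul_pone \<sigma>)

lemma subst_pmul:
  assumes "f \<in> fin_supp" "g \<in> fin_supp"
  shows "subst \<sigma> (pmul f g) = pmul (subst \<sigma> f) (subst \<sigma> g)"
  using assms(1)
proof (induction rule: fin_supp_induct)
  case (add c w f)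
  have "subst \<sigma> (pmul (mon w) g) = pmul (wprod \<sigma> w) (subst \<sigma> g)"
    using assms(2)
    by (induction rule: fin_supp_induct)
      (simp_all add: pmul_linear pmul_mon subst_mon subst_add subst_psmult subst_zero wprod_append
        mon_fin_supp pmul_fin_supp fin_supp_closed)
  with add show ?case
    by (simp add: pmul_linear subst_mon subst_add subst_psmult assms(2)
        mon_fin_supp pmul_fin_supp fin_supp_closed)
qed (simp add: pmul_linear subst_zero)

lemma subst_pbr:
  assumes "f \<in> fin_supp" "g \<in> fin_supp"
  shows "subst \<sigma> (pbr f g) = pbr (subst \<sigma> f) (subst \<sigma> g)"
  using assms by (simp add: pbr_conv subst_diff subst_pmul pmul_fin_supp)

end

section \<open>Lie polynomials and their grading\<close>

lemma subspace_lie_polys: "fp.subspace (lie_polys :: 'a::field fpoly set)"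
  using lie_polys.zero lie_polys.add lie_polys.smult
  by (intro fp.subspaceI) (simp_all add: padd_conv const_zero_conv)

lemmas lie_polys_closed =
  fp.subspace_0[OF subspace_lie_polys] fp.subspace_add[OF subspace_lie_polys]
  fp.subspace_diff[OF subspace_lie_polys] fp.subspace_scale[OF subspace_lie_polys]
  fp.subspace_neg[OF subspace_lie_polys] lie_polys.var lie_polys.br

lemma lie_polys_fin_supp: "f \<in> lie_polys \<Longrightarrow> f \<in> fin_supp"
  by (induction rule: lie_polys.induct)
    (simp_all add: pvar_conv mon_fin_supp padd_conv const_zero_conv pbr_conv pmul_fin_supp fin_supp_closed)

lemma hcomp_linear:
  "hcomp k (f + g) = hcomp k f + hcomp k g" "hcomp k (psmult c f) = psmult c (hcomp k f)"
  "hcomp k 0 = 0"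
  by (simp_all add: hcomp_def psmult_def fpoly_eq_iff)

definition hom :: "nat \<Rightarrow> 'a::field fpoly \<Rightarrow> bool" where
  "hom k f \<longleftrightarrow> (\<forall>w. f w \<noteq> 0 \<longrightarrow> wdeg w = k)"

lemma hcomp_hom: "hom k f \<Longrightarrow> hcomp l f = (if k = l then f else 0)"
  by (auto simp: hom_def hcomp_def fpoly_eq_iff)

lemma hcomp_eq_iff: "hcomp k f = f \<longleftrightarrow> hom k f"
  by (auto simp: hom_def hcomp_def fpoly_eq_iff)

lemma hom_pvar: "hom (vdeg x) (pvar x)"
  by (cases x) (simp_all add: hom_def pvar_def wdeg_def)

lemma hom_pvars: "hom 0 (pvar (Y i))" "hom 1 (pvar (Z i))" "hom (Suc 0) (pvar (Z i))" "hom 2 (pvar (W i))"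
  using hom_pvar[of "Y i"] hom_pvar[of "Z i"] hom_pvar[of "W i"] by simp_all

lemma hom_zero: "hom k 0"
  by (simp add: hom_def zero_fun_apply)

lemma hom_add: "hom k f \<Longrightarrow> hom k g \<Longrightarrow> hom k (f + g)"
  unfolding hom_def by (metis add_0_left plus_fun_apply)

lemma hom_psmult: "hom k f \<Longrightarrow> hom k (psmult c f)"
  by (simp add: hom_def psmult_def)

lemma hom_pmul:
  assumes "hom i f" "hom j g"
  shows "hom ((i + j) mod 3) (pmul f g)"
  unfolding hom_def
proof (intro allI impI)
  fix w assume "pmul f g w \<noteq> 0"
  then obtain k where "f (take k w) * g (drop k w) \<noteq> 0"
    unfolding pmul_def by (meson sum.not_neutral_contains_not_neutral)
  then have "wdeg (take k w) = i" "wdeg (drop k w) = j" using assms by (auto simp: hom_def)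
  moreover have "wdeg w = (wdeg (take k w) + wdeg (drop k w)) mod 3"
    unfolding wdeg_def by (metis append_take_drop_id map_append mod_add_eq sum_list.append)
  ultimately show "wdeg w = (i + j) mod 3" by simp
qed

lemma hom_pbr:
  assumes "hom i f" "hom j g" "k = (i + j) mod 3"
  shows "hom k (pbr f g)"
proof -
  have "hom k (pmul f g)" "hom k (pmul g f)"
    using hom_pmul[OF assms(1,2)] hom_pmul[OF assms(2,1)] assms(3) by (simp_all add: add.commute)
  then show ?thesis unfolding hom_def pbr_def by (metis diff_zero)
qed

lemma graded_subst_iff: "graded_subst \<sigma> \<longleftrightarrow> (\<forall>x. \<sigma> x \<in> lie_polys \<and> hom (vdeg x) (\<sigma> x))"
  by (simp add: graded_subst_def hcomp_eq_iff)

lemma graded_subst_fin_supp: "graded_subst \<sigma> \<Longrightarrow> \<sigma> x \<in> fin_supp"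
  by (simp add: graded_subst_iff lie_polys_fin_supp)

lemma subst_lie_polys:
  assumes "graded_subst \<sigma>" "f \<in> lie_polys"
  shows "subst \<sigma> f \<in> lie_polys"
  using assms(2)
proof (induction rule: lie_polys.induct)
  case (var x)
  then show ?case using assms(1) graded_subst_fin_supp[OF assms(1)]
    by (simp add: subst_pvar graded_subst_iff)
qed (simp_all add: padd_conv const_zero_conv subst_zero subst_add subst_psmult subst_pbr
    graded_subst_fin_supp[OF assms(1)] lie_polys_fin_supp lie_polys_closed)

text \<open>Linearity is demanded on Lie polynomials only: \<open>subst\<close> is a sum over a
  support, which collapses to 0 when the support is infinite.\<close>

definition lie_linear :: "('a::field fpoly \<Rightarrow> 'a fpoly) \<Rightarrow> bool" where
  "lie_linear T \<longleftrightarrow> (\<forall>f\<in>lie_polys. \<forall>g\<in>lie_polys. T (f + g) = T f + T g) \<and>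
    (\<forall>c. \<forall>f\<in>lie_polys. T (psmult c f) = psmult c (T f))"

lemma lie_linear_zero: "lie_linear T \<Longrightarrow> T 0 = 0"
  unfolding lie_linear_def by (metis fp.scale_zero_left lie_polys_closed(1))

lemma lie_linear_subst: "lie_linear (subst \<sigma>)"
  by (simp add: lie_linear_def subst_add subst_psmult lie_polys_fin_supp)

lemma lie_linear_id: "lie_linear (\<lambda>f. f)"
  by (simp add: lie_linear_def)

lemma lie_linear_scale: "lie_linear (psmult c)"
  by (simp add: lie_linear_def fp.scale_right_distrib mult.commute)

lemma lie_linear_comp:
  "lie_linear S \<Longrightarrow> lie_linear T \<Longrightarrow> (\<And>f. f \<in> lie_polys \<Longrightarrow> T f \<in> lie_polys) \<Longrightarrow>
    lie_linear (\<lambda>f. S (T f))"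
  by (simp add: lie_linear_def)

lemma lie_linear_add: "lie_linear S \<Longrightarrow> lie_linear T \<Longrightarrow> lie_linear (\<lambda>f. S f + T f)"
  by (simp add: lie_linear_def fp.scale_right_distrib algebra_simps)

lemma lie_linear_diff: "lie_linear S \<Longrightarrow> lie_linear T \<Longrightarrow> lie_linear (\<lambda>f. S f - T f)"
  by (simp add: lie_linear_def fp.scale_right_diff_distrib algebra_simps)

lemma span_lie_polys: "B \<subseteq> lie_polys \<Longrightarrow> f \<in> fp.span B \<Longrightarrow> f \<in> lie_polys"
  using fp.span_minimal subspace_lie_polys by blast

lemma lie_linear_span:
  assumes T: "lie_linear T" and B: "B \<subseteq> lie_polys" and U: "fp.subspace U"
    and "f \<in> fp.span B" "\<And>b. b \<in> B \<Longrightarrow> T b \<in> U"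
  shows "T f \<in> U"
proof -
  have "f \<in> lie_polys \<and> T f \<in> U"
    using assms(4)
  proof (induction rule: fp.span_induct_alt)
    case base
    then show ?case using lie_linear_zero[OF T] U fp.subspace_0 lie_polys_closed by metis
  next
    case (step c b g)
    then have b: "b \<in> lie_polys" "T b \<in> U" using B assms(5) by auto
    then have "T (psmult c b + g) = psmult c (T b) + T g"
      using T step lie_polys_closed(4) unfolding lie_linear_def by metis
    then show ?case using b step U by (simp add: lie_polys_closed fp.subspace_add fp.subspace_scale)
  qed
  then show ?thesis by blast
qed

lemma lie_linear_eq_on_span:
  assumes "lie_linear S" "lie_linear T" "B \<subseteq> lie_polys" "f \<in> fp.span B"
    "\<And>b. b \<in> B \<Longrightarrow> S b = T b"
  shows "S f = T f"
proof -
  have "S f - T f \<in> {0}"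
    by (rule lie_linear_span[OF lie_linear_diff[OF assms(1,2)] assms(3) fp.subspace_single_0 assms(4)])
      (simp add: assms(5))
  then show ?thesis by simp
qed

section \<open>Normal forms modulo the basic identities\<close>

definition base_ids :: "'a::field fpoly set" where
  "base_ids = {pbr (pvar (Y 0)) (pvar (Y 1)), pbr (pvar (Z 0)) (pvar (W 0)), pbr (pvar (W 0)) (pvar (W 1))}"

fun adY :: "'a::field fpoly \<Rightarrow> nat list \<Rightarrow> 'a fpoly" where
  "adY f [] = f"
| "adY f (i # xs) = pbr (adY f xs) (pvar (Y i))"

lemma adY_append: "adY f (xs @ ys) = adY (adY f ys) xs"
  by (induction xs) simp_all

lemma adY_lie: "f \<in> lie_polys \<Longrightarrow> adY f xs \<in> lie_polys"
  by (induction xs) (simp_all add: lie_polys_closed)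

lemma hom_adY: "k < 3 \<Longrightarrow> hom k f \<Longrightarrow> hom k (adY f xs)"
proof (induction xs)
  case (Cons i xs)
  then show ?case using hom_pvar[of "Y i"] by (auto intro: hom_pbr)
qed simp

lemma adY_add: "adY (f + g) xs = adY f xs + adY g xs"
  by (induction xs) (simp_all add: pbr_linear)

lemma adY_zero: "adY 0 xs = 0"
  by (induction xs) (simp_all add: pbr_linear)

lemma subst_adY:
  assumes "graded_subst \<sigma>" "f \<in> lie_polys" "\<And>i. \<sigma> (Y i) = pvar (Y (\<pi> i))"
  shows "subst \<sigma> (adY f xs) = adY (subst \<sigma> f) (map \<pi> xs)"
  using graded_subst_fin_supp[OF assms(1)]
  by (induction xs)
    (simp_all add: subst_pbr subst_pvar lie_polys_fin_supp adY_lie assms(2,3) lie_polys_closed)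

section \<open>Congruences modulo an ideal containing the basic identities\<close>

locale T_ideal =
  fixes K :: "'a::field fpoly set"
  assumes T_ideal: "is_TZ3_ideal K" and base: "base_ids \<subseteq> K"
begin

lemma sub_lie: "f \<in> K \<Longrightarrow> f \<in> lie_polys"
  using T_ideal unfolding is_TZ3_ideal_def by blast

lemma subspace: "fp.subspace K"
  using T_ideal unfolding is_TZ3_ideal_def
  by (intro fp.subspaceI) (simp_all add: padd_conv const_zero_conv)

lemmas closed = fp.subspace_0[OF subspace] fp.subspace_add[OF subspace]
  fp.subspace_diff[OF subspace] fp.subspace_scale[OF subspace] fp.subspace_neg[OF subspace]

lemma br: "f \<in> K \<Longrightarrow> g \<in> lie_polys \<Longrightarrow> pbr f g \<in> K"
  using T_ideal unfolding is_TZ3_ideal_def by blast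

lemma br': "f \<in> lie_polys \<Longrightarrow> g \<in> K \<Longrightarrow> pbr f g \<in> K"
  using br closed(5) pbr_anticomm by metis

lemma subst: "f \<in> K \<Longrightarrow> graded_subst \<sigma> \<Longrightarrow> subst \<sigma> f \<in> K"
  using T_ideal unfolding is_TZ3_ideal_def by blast

lemma hcomp: "f \<in> K \<Longrightarrow> k < 3 \<Longrightarrow> hcomp k f \<in> K"
  using T_ideal unfolding is_TZ3_ideal_def by blast

lemma cong_trans: "f - g \<in> K \<Longrightarrow> g - h \<in> K \<Longrightarrow> f - h \<in> K"
  using closed(2)[of "f - g" "g - h"] by simp

lemma cong_mem: "f - g \<in> K \<Longrightarrow> g \<in> K \<Longrightarrow> f \<in> K"
  using closed(2)[of "f - g" g] by simp

text \<open>Sending u to \<open>f\<close>, v to \<open>g\<close> and all other variables to 0 is a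
  graded substitution, so one identity in variables yields all its homogeneous instances.\<close>

lemma br_subst_vars:
  assumes "pbr (pvar u) (pvar v) \<in> K" "u \<noteq> v" "f \<in> lie_polys" "g \<in> lie_polys"
    "hom (vdeg u) f" "hom (vdeg v) g"
  shows "pbr f g \<in> K"
proof -
  define \<sigma> where "\<sigma> = (\<lambda>x. if x = u then f else if x = v then g else 0)"
  have \<sigma>: "graded_subst \<sigma>"
    using assms(3-6) by (simp add: graded_subst_iff \<sigma>_def hom_zero lie_polys_closed)
  have "subst \<sigma> (pbr (pvar u) (pvar v)) = pbr f g"
    using graded_subst_fin_supp[OF \<sigma>] assms(2)
    by (simp add: subst_pbr subst_pvar pvar_conv mon_fin_supp)
      (simp add: subst_pvar flip: pvar_conv, simp add: \<sigma>_def)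
  then show ?thesis using subst[OF assms(1) \<sigma>] by simp
qed

lemma br_00: "f \<in> lie_polys \<Longrightarrow> g \<in> lie_polys \<Longrightarrow> hom 0 f \<Longrightarrow> hom 0 g \<Longrightarrow> pbr f g \<in> K"
  using base by - (rule br_subst_vars[of "Y 0" "Y 1"], auto simp: base_ids_def)

lemma br_12: "f \<in> lie_polys \<Longrightarrow> g \<in> lie_polys \<Longrightarrow> hom 1 f \<Longrightarrow> hom 2 g \<Longrightarrow> pbr f g \<in> K"
  using base by - (rule br_subst_vars[of "Z 0" "W 0"], auto simp: base_ids_def)

lemma br_22: "f \<in> lie_polys \<Longrightarrow> g \<in> lie_polys \<Longrightarrow> hom 2 f \<Longrightarrow> hom 2 g \<Longrightarrow> pbr f g \<in> K"
  using base by - (rule br_subst_vars[of "W 0" "W 1"], auto simp: base_ids_def)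

text \<open>By Jacobi the difference is a bracket with \<open>[y_j, y_i]\<close>, which lies in
  \<open>K\<close>.\<close>

lemma adY_swap:
  assumes f: "f \<in> lie_polys"
  shows "adY f (i # j # xs) - adY f (j # i # xs) \<in> K"
proof -
  have "adY f (i # j # xs) - adY f (j # i # xs) = pbr (adY f xs) (pbr (pvar (Y j)) (pvar (Y i)))"
    using pbr_jacobi[of "adY f xs" "pvar (Y j)" "pvar (Y i)"] f
    by (simp add: lie_polys_fin_supp adY_lie lie_polys_closed)
  moreover have "pbr (pvar (Y j)) (pvar (Y i)) \<in> K"
    using hom_pvar[of "Y i"] hom_pvar[of "Y j"] by (intro br_00) (simp_all add: lie_polys_closed)
  ultimately show ?thesis using f by (simp add: br' adY_lie)
qed

lemma adY_cong_Cons: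
  assumes "adY f xs - adY f ys \<in> K"
  shows "adY f (i # xs) - adY f (i # ys) \<in> K"
  using br[OF assms lie_polys.var[of "Y i"]] by (simp add: pbr_linear)

lemma adY_perm:
  assumes f: "f \<in> lie_polys" and "mset xs = mset ys"
  shows "adY f xs - adY f ys \<in> K"
  using assms(2)
proof (induction xs arbitrary: ys)
  case Nil
  then show ?case by (simp add: closed)
next
  case (Cons x xs)
  have "x \<in> set ys" using Cons.prems by (metis list.set_intros(1) set_mset_mset)
  then obtain us vs where ys: "ys = us @ x # vs" by (meson split_list)
  \<comment> \<open>Adjacent swaps carry \<open>x\<close> from its place in \<open>ys\<close> to the
    front.\<close>
  have front: "adY f (x # us @ vs) - adY f (us @ x # vs) \<in> K"
  proof (induction us)
    case (Cons u us)
    have "adY f (x # (u # us) @ vs) - adY f (u # x # us @ vs) \<in> K"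
      using adY_swap[OF f] by simp
    moreover have "adY f (u # x # us @ vs) - adY f ((u # us) @ x # vs) \<in> K"
      using adY_cong_Cons[OF Cons] by simp
    ultimately show ?case by (rule cong_trans)
  qed (simp add: closed)
  have "adY f xs - adY f (us @ vs) \<in> K" using Cons.prems ys by (intro Cons.IH) simp
  then have "adY f (x # xs) - adY f (x # us @ vs) \<in> K" by (rule adY_cong_Cons)
  then show ?case using front ys cong_trans by blast
qed

lemma pbr_cong:
  assumes "f - f' \<in> K" "g - g' \<in> K" "f' \<in> lie_polys" "g \<in> lie_polys"
  shows "pbr f g - pbr f' g' \<in> K"
proof -
  have "pbr f g - pbr f' g' = pbr (f - f') g + pbr f' (g - g')" by (simp add: pbr_linear)
  then show ?thesis using assms by (simp add: closed br br')
qed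

end

lemma T_ideal_iff: "T_ideal K \<longleftrightarrow> is_TZ3_ideal K \<and> base_ids \<subseteq> K"
  by (simp add: T_ideal_def)

section \<open>Spanning sets in degrees 0, 1 and 2\<close>

definition basis_z :: "nat \<Rightarrow> 'a::field fpoly set" where
  "basis_z k = range (adY (pvar (Z k)))"

definition basis_w :: "nat \<Rightarrow> 'a::field fpoly set" where
  "basis_w k = range (adY (pvar (W k)))"

definition basis_zz :: "nat \<Rightarrow> nat \<Rightarrow> 'a::field fpoly set" where
  "basis_zz k l = {pbr (adY (pvar (Z k)) xs) (adY (pvar (Z l)) ys) | xs ys. True}"

definition basis0 :: "'a::field fpoly set" where
  "basis0 = range (\<lambda>i. pvar (Y i))"

definition basis1 :: "'a::field fpoly set" where
  "basis1 = (\<Union>k. basis_z k)"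

definition basis2 :: "'a::field fpoly set" where
  "basis2 = (\<Union>k. basis_w k) \<union> (\<Union>k l. basis_zz k l)"

lemma pbr_adY_basis2: "pbr (adY (pvar (Z k)) xs) (adY (pvar (Z l)) ys) \<in> basis2"
  unfolding basis2_def basis_zz_def by blast

lemma hom_basis0: "b \<in> basis0 \<Longrightarrow> hom 0 b"
  using hom_pvar[of "Y _"] by (auto simp: basis0_def)

lemma hom_basis1: "b \<in> basis1 \<Longrightarrow> hom 1 b"
  using hom_pvar[of "Z _"] by (auto simp: basis1_def basis_z_def intro!: hom_adY)

lemma hom_basis2: "b \<in> basis2 \<Longrightarrow> hom 2 b"
  using hom_pvar[of "Z _"] hom_pvar[of "W _"]
  by (auto simp: basis2_def basis_w_def basis_zz_def intro!: hom_adY hom_pbr[of 1 _ 1])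

lemma basis_lie: "basis0 \<subseteq> lie_polys" "basis1 \<subseteq> lie_polys" "basis2 \<subseteq> lie_polys"
  "basis_z k \<subseteq> lie_polys" "basis_w k \<subseteq> lie_polys" "basis_zz k l \<subseteq> lie_polys"
  by (auto simp: basis0_def basis1_def basis2_def basis_z_def basis_w_def basis_zz_def
      adY_lie lie_polys_closed)

lemma hom_span:
  assumes "f \<in> fp.span B" "\<And>b. b \<in> B \<Longrightarrow> hom k b"
  shows "hom k f"
  using assms(1) by (induction rule: fp.span_induct_alt) (simp_all add: hom_zero hom_add hom_psmult assms(2))

lemma pbr_span:
  assumes "f \<in> fp.span A" "g \<in> fp.span B" "\<And>a b. a \<in> A \<Longrightarrow> b \<in> B \<Longrightarrow> pbr a b \<in> fp.span C"
  shows "pbr f g \<in> fp.span C"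
  using assms(1)
proof (induction rule: fp.span_induct_alt)
  case (step c a f)
  have "pbr a g \<in> fp.span C"
    using assms(2) by (induction rule: fp.span_induct_alt)
      (simp_all add: pbr_linear fp.span_zero fp.span_add fp.span_scale assms(3) step)
  with step show ?case by (simp add: pbr_linear fp.span_add fp.span_scale)
qed (simp add: pbr_linear fp.span_zero)

context T_ideal
begin

abbreviation "normal_gens \<equiv> basis0 \<union> basis1 \<union> basis2 \<union> K"

text \<open>By degrees: brackets of types (0,0), (1,2) and (2,2) lie in \<open>K\<close>; types
  (1,0) and (1,1) give generators and type (2,0) a generator or a sum of two. The remaining types
  follow by anticommutativity. Hence the span of the generators is closed under brackets.\<close>

lemma pbr_normal_gens:
  assumes "a \<in> normal_gens" "b \<in> normal_gens"
  shows "pbr a b \<in> fp.span normal_gens"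
proof -
  let ?N = "fp.span normal_gens"
  have inK: "f \<in> ?N" if "f \<in> K" for f using that by (simp add: fp.span_base)
  have sym: "pbr b a \<in> ?N" if "pbr a b \<in> ?N" for a b
    using fp.span_neg[OF that] by (simp add: pbr_anticomm[of b a])
  have lie: "a \<in> lie_polys" if "a \<in> normal_gens" for a using that basis_lie sub_lie by blast
  have K1: "pbr a b \<in> ?N" if "a \<in> K" "b \<in> normal_gens" for a b
    using that lie by (intro inK br) blast+
  have 00: "pbr a b \<in> ?N" if "a \<in> basis0" "b \<in> basis0" for a b
    using that basis_lie hom_basis0 by (intro inK br_00) blast+
  have 10: "pbr a b \<in> ?N" if ab: "a \<in> basis1" "b \<in> basis0" for a b
  proof -
    obtain k xs i where "a = adY (pvar (Z k)) xs" "b = pvar (Y i)"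
      using ab by (auto simp: basis0_def basis1_def basis_z_def)
    then have "pbr a b = adY (pvar (Z k)) (i # xs)" by simp
    then have "pbr a b \<in> basis1" unfolding basis1_def basis_z_def by blast
    then show ?thesis by (simp add: fp.span_base)
  qed
  have 11: "pbr a b \<in> ?N" if "a \<in> basis1" "b \<in> basis1" for a b
  proof -
    have "pbr a b \<in> basis2"
      using that by (auto simp: basis1_def basis_z_def pbr_adY_basis2)
    then show ?thesis by (simp add: fp.span_base)
  qed
  have 20: "pbr a b \<in> ?N" if ab: "a \<in> basis2" "b \<in> basis0" for a b
  proof -
    obtain i where b: "b = pvar (Y i)" using ab by (auto simp: basis0_def)
    consider k xs where "a = adY (pvar (W k)) xs"
      | k xs l ys where "a = pbr (adY (pvar (Z k)) xs) (adY (pvar (Z l)) ys)"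
      using ab by (auto simp: basis2_def basis_w_def basis_zz_def)
    then show ?thesis
    proof cases
      case 1
      then have "pbr a b = adY (pvar (W k)) (i # xs)" using b by simp
      then have "pbr a b \<in> basis2" unfolding basis2_def basis_w_def by blast
      then show ?thesis by (simp add: fp.span_base)
    next
      case 2
      \<comment> \<open>Jacobi distributes the new y over the two factors.\<close>
      then have "pbr a b = pbr (adY (pvar (Z k)) (i # xs)) (adY (pvar (Z l)) ys) +
          pbr (adY (pvar (Z k)) xs) (adY (pvar (Z l)) (i # ys))"
        using b by (simp add: pbr_jacobi[of _ "adY (pvar (Z l)) ys"] lie_polys_fin_supp adY_lie lie_polys_closed)
      then show ?thesis
        by (simp only:) (intro fp.span_add fp.span_base UnI1 UnI2 pbr_adY_basis2)
    qed
  qed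
  have 12: "pbr a b \<in> ?N" if "a \<in> basis1" "b \<in> basis2" for a b
    using that basis_lie hom_basis1 hom_basis2 by (intro inK br_12) blast+
  have 22: "pbr a b \<in> ?N" if "a \<in> basis2" "b \<in> basis2" for a b
    using that basis_lie hom_basis2 by (intro inK br_22) blast+
  consider "a \<in> K" | "b \<in> K" | "a \<in> basis0 \<union> basis1 \<union> basis2" "b \<in> basis0 \<union> basis1 \<union> basis2"
    using assms by blast
  then show ?thesis
  proof cases
    case 3
    then show ?thesis using 00 10 11 20 12 22 sym by blast
  qed (use K1 assms sym in blast)+
qed

text \<open>The span of \<open>normal_gens\<close> contains the variables and is closed under
  brackets, hence contains every Lie polynomial.\<close>

lemma normal_form:
  assumes "f \<in> lie_polys"
  obtains a b c where "a \<in> fp.span basis0" "b \<in> fp.span basis1" "c \<in> fp.span basis2"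
    "f - (a + b + c) \<in> K"
proof -
  have "f \<in> fp.span normal_gens"
    using assms
  proof (induction rule: lie_polys.induct)
    case (var x)
    have "pvar x \<in> normal_gens"
      using rangeI[of "adY (pvar x)" "[]"]
      by (cases x) (auto simp: basis0_def basis1_def basis2_def basis_z_def basis_w_def)
    then show ?case by (rule fp.span_base)
  next
    case (br f g)
    then show ?case using pbr_span pbr_normal_gens by blast
  qed (simp_all add: padd_conv const_zero_conv fp.span_zero fp.span_add fp.span_scale)
  then obtain a b c k where "a \<in> fp.span basis0" "b \<in> fp.span basis1" "c \<in> fp.span basis2"
    "k \<in> fp.span K" "f = a + b + c + k"
    unfolding fp.span_Un by blast
  moreover have "fp.span K = K" using subspace by (simp add: fp.span_eq_iff)
  ultimately show ?thesis by (intro that[of a b c]) simp_all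
qed

end

section \<open>Noetherianity by leading monomials\<close>

text \<open>The families \<open>\<Phi>\<close> below send a list of codes, read as a monomial, to a Lie polynomial which up to
  the identities \<^const>\<open>base_ids\<close> depends only on the monomial. Linear independence of the \<open>\<Phi> cs\<close>
  modulo the identities is not needed, since only the set of leading monomials is compared.\<close>

locale monomial_family =
  fixes \<Phi> :: "nat list \<Rightarrow> 'a::field fpoly"
  assumes lie: "\<Phi> cs \<in> lie_polys"
    and perm: "T_ideal K \<Longrightarrow> mset cs = mset ds \<Longrightarrow> \<Phi> cs - \<Phi> ds \<in> K"
    and relabel: "\<exists>\<sigma>. graded_subst \<sigma> \<and> (\<forall>cs. subst \<sigma> (\<Phi> cs) = \<Phi> (map (block_map \<pi>) cs @ ns))"
begin

definition below :: "nat multiset \<Rightarrow> 'a fpoly set" where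
  "below m = fp.span (\<Phi> ` {cs. mset cs < m})"

definition atmost :: "nat multiset \<Rightarrow> 'a fpoly set" where
  "atmost m = fp.span (\<Phi> ` {cs. mset cs \<le> m})"

text \<open>An element of \<open>K\<close> may have several representations by the
  \<open>\<Phi> cs\<close>; a monomial counts as leading as soon as one monic representation has it
  on top.\<close>

definition lead :: "'a fpoly set \<Rightarrow> nat multiset set" where
  "lead K = {m. \<exists>cs r. mset cs = m \<and> r \<in> below m \<and> \<Phi> cs + r \<in> K}"

lemma image_lie: "\<Phi> ` A \<subseteq> lie_polys"
  using lie by blast

lemma below_lie: "r \<in> below m \<Longrightarrow> r \<in> lie_polys"
  unfolding below_def using span_lie_polys image_lie by blast

text \<open>The substitution that relabels and multiplies by the cofactor \<open>ns\<close>
  preserves \<open>K\<close>. It sends lower terms to lower terms, because the monomial order is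
  compatible with both operations.\<close>

lemma lead_shift_dvd:
  assumes "T_ideal K" "m \<in> lead K" "shift_dvd m n"
  shows "n \<in> lead K"
proof -
  interpret T_ideal K by fact
  obtain cs r where cs: "mset cs = m" "r \<in> below m" "\<Phi> cs + r \<in> K"
    using assms(2) by (auto simp: lead_def)
  obtain \<pi> where \<pi>: "strict_mono \<pi>" "image_mset (block_map \<pi>) m \<subseteq># n"
    using assms(3) by (auto simp: shift_dvd_def)
  obtain ns where ns: "mset ns = n - image_mset (block_map \<pi>) m" using ex_mset by blast
  obtain \<sigma> where \<sigma>: "graded_subst \<sigma>" "\<And>cs. subst \<sigma> (\<Phi> cs) = \<Phi> (map (block_map \<pi>) cs @ ns)"
    using relabel by blast
  have n: "n = image_mset (block_map \<pi>) m + mset ns" using \<pi>(2) ns by simp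
  have "subst \<sigma> r \<in> below n"
    unfolding below_def
  proof (rule lie_linear_span[OF lie_linear_subst image_lie fp.subspace_span cs(2)[unfolded below_def]])
    fix b assume "b \<in> \<Phi> ` {cs. mset cs < m}"
    then obtain ds where ds: "mset ds < m" "b = \<Phi> ds" by blast
    have "mset (map (block_map \<pi>) ds @ ns) < n"
      using less_image_mset_strict_mono[OF strict_mono_block_map[OF \<pi>(1)] ds(1)] n by simp
    then show "subst \<sigma> b \<in> fp.span (\<Phi> ` {cs. mset cs < n})"
      using \<sigma>(2) ds(2) by (intro fp.span_base) auto
  qed
  moreover have "subst \<sigma> (\<Phi> cs + r) = \<Phi> (map (block_map \<pi>) cs @ ns) + subst \<sigma> r"
    using \<sigma>(2) by (simp add: subst_add lie_polys_fin_supp lie below_lie[OF cs(2)])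
  then have "\<Phi> (map (block_map \<pi>) cs @ ns) + subst \<sigma> r \<in> K"
    using subst[OF cs(3) \<sigma>(1)] by simp
  moreover have "mset (map (block_map \<pi>) cs @ ns) = n" using n cs(1) by simp
  ultimately show ?thesis unfolding lead_def by blast
qed

lemma atmost_mono: "m \<le> n \<Longrightarrow> atmost m \<subseteq> atmost n"
  unfolding atmost_def by (intro fp.span_mono) auto

text \<open>The monomial order is linear, so a linear combination is bounded by the largest monomial
  used in it.\<close>

lemma span_image_atmost:
  assumes "f \<in> fp.span (\<Phi> ` A)"
  shows "f = 0 \<or> (\<exists>cs\<in>A. f \<in> atmost (mset cs))"
  using assms
proof (induction rule: fp.span_induct_alt)
  case (step c b g)
  obtain cs where cs: "cs \<in> A" "b = \<Phi> cs" using step by blast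
  have b: "psmult c b \<in> atmost (mset cs)"
    unfolding atmost_def cs by (intro fp.span_scale fp.span_base) auto
  show ?case
  proof (cases "g = 0")
    case True
    then show ?thesis using b cs by auto
  next
    case False
    then obtain ds where ds: "ds \<in> A" "g \<in> atmost (mset ds)" using step by blast
    define es where "es = (if mset cs \<le> mset ds then ds else cs)"
    have "psmult c b \<in> atmost (mset es)" "g \<in> atmost (mset es)"
      using b ds(2) atmost_mono[of "mset cs" "mset ds"] atmost_mono[of "mset ds" "mset cs"]
        linear[of "mset cs" "mset ds"]
      by (auto simp: es_def)
    then have "psmult c b + g \<in> atmost (mset es)" unfolding atmost_def by (rule fp.span_add)
    moreover have "es \<in> A" using cs ds by (simp add: es_def)
    ultimately show ?thesis by blast
  qed
qed simp

text \<open>All lists with the same monomial give congruent values of \<open>\<Phi>\<close>, so the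
  top part collapses modulo \<open>K\<close> to one multiple of \<open>\<Phi> cs\<close>.\<close>

lemma atmost_decomp:
  assumes "T_ideal K" "f \<in> atmost (mset cs)"
  obtains c r where "r \<in> below (mset cs)" "f - (psmult c (\<Phi> cs) + r) \<in> K"
proof -
  interpret T_ideal K by fact
  have "{ds. mset ds \<le> mset cs} = {ds. mset ds = mset cs} \<union> {ds. mset ds < mset cs}" by auto
  then have "f \<in> fp.span (\<Phi> ` {ds. mset ds = mset cs} \<union> \<Phi> ` {ds. mset ds < mset cs})"
    using assms(2) by (simp add: atmost_def image_Un)
  then obtain x r where xr: "x \<in> fp.span (\<Phi> ` {ds. mset ds = mset cs})" "r \<in> below (mset cs)" "f = x + r"
    unfolding fp.span_Un below_def by blast
  have "\<exists>c. x - psmult c (\<Phi> cs) \<in> K"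
    using xr(1)
  proof (induction rule: fp.span_induct_alt)
    case base
    show ?case by (rule exI[of _ 0]) (simp add: closed)
  next
    case (step c b y)
    then obtain ds d where ds: "mset ds = mset cs" "b = \<Phi> ds" and d: "y - psmult d (\<Phi> cs) \<in> K" by blast
    have "psmult c (\<Phi> ds - \<Phi> cs) + (y - psmult d (\<Phi> cs)) \<in> K"
      by (intro closed d perm[OF assms(1) ds(1)])
    then have "psmult c b + y - psmult (c + d) (\<Phi> cs) \<in> K"
      by (simp add: ds(2) fp.scale_left_distrib fp.scale_right_diff_distrib algebra_simps)
    then show ?case by blast
  qed
  then show ?thesis using that[OF xr(2)] xr(3) by (metis add_diff_cancel_right)
qed

text \<open>Groebner reduction by well-founded induction on the bounding monomial: the top term of
  an element of \<open>J\<close> is cancelled by an element of \<open>K\<close> with the same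
  leading monomial.\<close>

lemma mem_of_lead_subset:
  assumes "T_ideal J" "T_ideal K" "K \<subseteq> J" "lead J \<subseteq> lead K"
    and "f \<in> J" "f \<in> fp.span (range \<Phi>)"
  shows "f \<in> K"
proof -
  interpret J: T_ideal J by fact
  interpret K: T_ideal K by fact
  have atmost_case: "f \<in> K" if "f \<in> J" "f \<in> atmost m" for f m
    using that
  proof (induction m arbitrary: f rule: less_induct)
    case (less m)
    have IH: "g \<in> K" if "g \<in> J" "g \<in> below m" for g
      using span_image_atmost[OF that(2)[unfolded below_def]] less.IH that(1) K.closed(1) by blast
    obtain cs where cs: "mset cs = m" using ex_mset by blast
    obtain c r where cr: "r \<in> below m" "f - (psmult c (\<Phi> cs) + r) \<in> K"
      using atmost_decomp[OF assms(2), of f cs] less.prems(2) cs by blast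
    have J: "psmult c (\<Phi> cs) + r \<in> J"
      using J.closed(3)[OF less.prems(1), of "f - (psmult c (\<Phi> cs) + r)"] cr(2) assms(3) by auto
    have "psmult c (\<Phi> cs) + r \<in> K"
    proof (cases "c = 0")
      case True
      then show ?thesis using IH J cr(1) by simp
    next
      case False
      have "\<Phi> cs + psmult (inverse c) r \<in> J"
        using J.closed(4)[OF J, of "inverse c"] False by (simp add: fp.scale_right_distrib)
      moreover have "psmult (inverse c) r \<in> below m"
        using cr(1) unfolding below_def by (rule fp.span_scale)
      ultimately have "m \<in> lead K" using assms(4) cs unfolding lead_def by blast
      then obtain ds s where ds: "mset ds = m" "s \<in> below m" "\<Phi> ds + s \<in> K"
        unfolding lead_def by blast
      have swap: "psmult c (\<Phi> cs - \<Phi> ds) \<in> K" using perm[OF assms(2)] cs ds(1) K.closed(4) by simp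
      have K: "psmult c (\<Phi> ds + s) \<in> K" by (rule K.closed(4)[OF ds(3)])
      \<comment> \<open>The last two summands lie in \<open>K\<close>; the first is again in
        \<open>J\<close> but strictly below \<open>m\<close>, so the induction hypothesis applies to
        it.\<close>
      have eq: "psmult c (\<Phi> cs) + r = (r - psmult c s) + psmult c (\<Phi> cs - \<Phi> ds) + psmult c (\<Phi> ds + s)"
        by (simp add: fp.scale_right_distrib fp.scale_right_diff_distrib)
      have "r - psmult c s = psmult c (\<Phi> cs) + r - psmult c (\<Phi> cs - \<Phi> ds) - psmult c (\<Phi> ds + s)"
        using eq by simp
      then have "r - psmult c s \<in> J" using J swap K assms(3) J.closed(3) by (metis subsetD)
      moreover have "r - psmult c s \<in> below m"
        using cr(1) ds(2) unfolding below_def by (intro fp.span_diff fp.span_scale)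
      ultimately have "r - psmult c s \<in> K" by (rule IH)
      then show ?thesis unfolding eq by (intro K.closed(2) swap K)
    qed
    then show ?case using cr(2) K.cong_mem by blast
  qed
  show ?thesis using span_image_atmost[OF assms(6)] atmost_case assms(5) K.closed(1) by blast
qed

text \<open>\<open>S\<close> consists of one element of \<open>J\<close> for each monomial in a
  finite basis of \<open>lead J\<close> under \<open>shift_dvd\<close>. If \<open>K\<close> contains
  \<open>S\<close>, upward closure of \<open>lead K\<close> gives
  \<open>lead J \<subseteq> lead K\<close>. The same \<open>S\<close> serves all
  \<open>K\<close>.\<close>

lemma finite_generation:
  assumes "T_ideal J"
  obtains S where "finite S" "S \<subseteq> J"
    "\<And>K f. T_ideal K \<Longrightarrow> K \<subseteq> J \<Longrightarrow> S \<subseteq> K \<Longrightarrow> f \<in> J \<Longrightarrow> f \<in> fp.span (range \<Phi>) \<Longrightarrow> f \<in> K"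
proof -
  obtain B where B: "finite B" "B \<subseteq> lead J" "\<forall>n\<in>lead J. \<exists>m\<in>B. shift_dvd m n"
    using almost_full_finite_basis[OF almost_full_shift_dvd, of "lead J"] by blast
  have "\<forall>m\<in>B. \<exists>h. h \<in> J \<and> (\<exists>cs r. mset cs = m \<and> r \<in> below m \<and> h = \<Phi> cs + r)"
    using B(2) by (fastforce simp: lead_def)
  then obtain h where h: "\<forall>m\<in>B. h m \<in> J \<and> (\<exists>cs r. mset cs = m \<and> r \<in> below m \<and> h m = \<Phi> cs + r)"
    by (rule bchoice[THEN exE])
  show ?thesis
  proof (rule that)
    show "finite (h ` B)" "h ` B \<subseteq> J" using B(1) h by auto
    fix K f assume K: "T_ideal K" "K \<subseteq> J" "h ` B \<subseteq> K" and f: "f \<in> J" "f \<in> fp.span (range \<Phi>)"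
    have "B \<subseteq> lead K"
    proof
      fix m assume "m \<in> B"
      then have "h m \<in> K" using K(3) by blast
      then show "m \<in> lead K" using h \<open>m \<in> B\<close> unfolding lead_def by (metis (mono_tags, lifting) mem_Collect_eq)
    qed
    then have "lead J \<subseteq> lead K" using B(3) lead_shift_dvd[OF K(1)] by blast
    then show "f \<in> K" using mem_of_lead_subset[OF assms K(1,2)] f by blast
  qed
qed

end

section \<open>The monomial families with one and with two factors\<close>

definition halves :: "(nat \<Rightarrow> bool) \<Rightarrow> nat list \<Rightarrow> nat list" where
  "halves P cs = map (\<lambda>c. c div 2) (filter P cs)"

lemma halves_append: "halves P (cs @ ds) = halves P cs @ halves P ds"
  by (simp add: halves_def)

lemma block_map_div: "block_map \<pi> c div 2 = \<pi> (c div 2)"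
  by (simp add: block_map_def)

lemma even_block_map: "even (block_map \<pi> c) = even c"
  by (simp add: block_map_def)

lemma halves_block_map:
  "halves (\<lambda>_. True) (map (block_map \<pi>) cs) = map \<pi> (halves (\<lambda>_. True) cs)"
  "halves even (map (block_map \<pi>) cs) = map \<pi> (halves even cs)"
  "halves odd (map (block_map \<pi>) cs) = map \<pi> (halves odd cs)"
  by (simp_all add: halves_def filter_map block_map_div even_block_map o_def)

lemma mset_halves: "mset cs = mset ds \<Longrightarrow> mset (halves P cs) = mset (halves P ds)"
  by (simp add: halves_def)

lemma halves_double:
  "halves (\<lambda>_. True) (map (\<lambda>i. 2 * i) xs) = xs"
  "halves even (map (\<lambda>i. 2 * i) xs @ map (\<lambda>i. 2 * i + 1) ys) = xs"
  "halves odd (map (\<lambda>i. 2 * i) xs @ map (\<lambda>i. 2 * i + 1) ys) = ys"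
  by (simp_all add: halves_def filter_map o_def)

text \<open>With a single factor the parity of a code is ignored: u_i and v_i both stand for
  bracketing with y_i.\<close>

definition family1 :: "var \<Rightarrow> nat list \<Rightarrow> 'a::field fpoly" where
  "family1 v cs = adY (pvar v) (halves (\<lambda>_. True) cs)"

definition family2 :: "nat list \<Rightarrow> 'a::field fpoly" where
  "family2 cs = pbr (adY (pvar (Z 0)) (halves even cs)) (adY (pvar (Z 1)) (halves odd cs))"

lemma vdeg_less: "vdeg v < 3"
  by (cases v) simp_all

lemma range_family1: "range (family1 v) = range (adY (pvar v))"
proof -
  have "adY (pvar v) xs = family1 v (map (\<lambda>i. 2 * i) xs)" for xs
    by (simp add: family1_def halves_double)
  then show ?thesis by (auto simp: family1_def)
qed

lemma range_family2: "range family2 = basis_zz 0 1"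
proof -
  have "pbr (adY (pvar (Z 0)) xs) (adY (pvar (Z 1)) ys) =
      family2 (map (\<lambda>i. 2 * i) xs @ map (\<lambda>i. 2 * i + 1) ys)" for xs ys
    by (simp only: family2_def halves_double)
  then show ?thesis by (auto simp: basis_zz_def family2_def)
qed

lemma monomial_family1:
  assumes "vdeg v \<noteq> 0"
  shows "monomial_family (family1 v :: nat list \<Rightarrow> 'a::field fpoly)"
proof
  show "family1 v cs \<in> lie_polys" for cs
    by (simp add: family1_def adY_lie lie_polys_closed)
  show "family1 v cs - family1 v ds \<in> K" if "T_ideal K" "mset cs = mset ds" for K :: "'a fpoly set" and cs ds
    unfolding family1_def using that
    by (intro T_ideal.adY_perm mset_halves) (simp_all add: lie_polys_closed)
  show "\<exists>\<sigma>. graded_subst \<sigma> \<and> (\<forall>cs. subst \<sigma> (family1 v cs) = (family1 v (map (block_map \<pi>) cs @ ns) :: 'a fpoly))"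
    for \<pi> ns
  proof -
    \<comment> \<open>The y's are relabelled by \<open>\<pi>\<close>, while the other variables
      absorb the cofactor \<open>ns\<close> as inner brackets.\<close>
    define \<sigma> :: "var \<Rightarrow> 'a fpoly" where "\<sigma> = (\<lambda>x. case x of Y i \<Rightarrow> pvar (Y (\<pi> i))
      | _ \<Rightarrow> adY (pvar x) (halves (\<lambda>_. True) ns))"
    have \<sigma>: "graded_subst \<sigma>"
      unfolding graded_subst_iff
    proof
      fix x
      show "\<sigma> x \<in> lie_polys \<and> hom (vdeg x) (\<sigma> x)"
        using hom_pvar[of x] hom_pvar[of "Y _"] hom_adY[OF vdeg_less hom_pvar, of x]
        by (cases x) (auto simp: \<sigma>_def adY_lie lie_polys_closed)
    qed
    have v: "subst \<sigma> (pvar v) = adY (pvar v) (halves (\<lambda>_. True) ns)"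
      using graded_subst_fin_supp[OF \<sigma>] assms by (cases v) (simp_all add: subst_pvar \<sigma>_def)
    have "subst \<sigma> (family1 v cs) = family1 v (map (block_map \<pi>) cs @ ns)" for cs
      unfolding family1_def halves_append halves_block_map adY_append v[symmetric]
      by (rule subst_adY[OF \<sigma>]) (simp_all add: \<sigma>_def lie_polys_closed)
    with \<sigma> show ?thesis by blast
  qed
qed

lemma monomial_family2: "monomial_family (family2 :: nat list \<Rightarrow> 'a::field fpoly)"
proof
  show "family2 cs \<in> lie_polys" for cs
    by (simp add: family2_def adY_lie lie_polys_closed)
  show "family2 cs - family2 ds \<in> K" if "T_ideal K" "mset cs = mset ds" for K :: "'a fpoly set" and cs ds
    unfolding family2_def using that
    by (intro T_ideal.pbr_cong T_ideal.adY_perm mset_halves) (simp_all add: adY_lie lie_polys_closed)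
  show "\<exists>\<sigma>. graded_subst \<sigma> \<and> (\<forall>cs. subst \<sigma> (family2 cs) = (family2 (map (block_map \<pi>) cs @ ns) :: 'a fpoly))"
    for \<pi> ns
  proof -
    \<comment> \<open>The u part of the cofactor is absorbed by z_0 and its v part by z_1.\<close>
    define \<sigma> :: "var \<Rightarrow> 'a fpoly" where "\<sigma> = (\<lambda>x. case x of Y i \<Rightarrow> pvar (Y (\<pi> i))
      | Z k \<Rightarrow> adY (pvar x) (halves (if k = 0 then even else odd) ns) | W _ \<Rightarrow> pvar x)"
    have \<sigma>: "graded_subst \<sigma>"
      unfolding graded_subst_iff
    proof
      fix x
      show "\<sigma> x \<in> lie_polys \<and> hom (vdeg x) (\<sigma> x)"
        using hom_pvar[of x] hom_pvar[of "Y _"] hom_adY[OF vdeg_less hom_pvar, of x]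
        by (cases x) (auto simp: \<sigma>_def adY_lie lie_polys_closed)
    qed
    have v: "subst \<sigma> (pvar (Z 0)) = adY (pvar (Z 0)) (halves even ns)"
      "subst \<sigma> (pvar (Z 1)) = adY (pvar (Z 1)) (halves odd ns)"
      using graded_subst_fin_supp[OF \<sigma>] by (simp_all add: subst_pvar \<sigma>_def)
    have ad: "subst \<sigma> (adY (pvar x) xs) = adY (subst \<sigma> (pvar x)) (map \<pi> xs)" for x xs
      by (rule subst_adY[OF \<sigma>]) (simp_all add: \<sigma>_def lie_polys_closed)
    have "subst \<sigma> (family2 cs) = family2 (map (block_map \<pi>) cs @ ns)" for cs
      using graded_subst_fin_supp[OF \<sigma>]
      by (simp add: family2_def halves_append halves_block_map adY_append subst_pbr
          lie_polys_fin_supp adY_lie lie_polys_closed ad v v(2)[simplified])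
    with \<sigma> show ?thesis by blast
  qed
qed

section \<open>Separation of variables and linearization\<close>

lemma lie_linear_sum:
  assumes "\<And>i. i \<in> I \<Longrightarrow> lie_linear (T i)"
  shows "lie_linear (\<lambda>f. \<Sum>i\<in>I. T i f)"
  using assms
proof (induction I rule: infinite_finite_induct)
  case (insert i I)
  then show ?case using lie_linear_add[of "T i" "\<lambda>f. \<Sum>i\<in>I. T i f"] by simp
qed (simp_all add: lie_linear_def)

text \<open>Serves to write \<open>f\<close> as a finite sum of projections: a sum over the first n
  variables fixes each generator from some n on, and \<open>f\<close> involves finitely many
  generators.\<close>

lemma lie_linear_eventually_id:
  fixes T :: "nat \<Rightarrow> 'a::field fpoly \<Rightarrow> 'a fpoly"
  assumes T: "\<And>n. lie_linear (T n)" and B: "B \<subseteq> lie_polys"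
    and "\<And>b. b \<in> B \<Longrightarrow> \<exists>N. \<forall>n\<ge>N. T n b = b" and "f \<in> fp.span B"
  shows "\<exists>N. \<forall>n\<ge>N. T n f = f"
proof -
  have "f \<in> lie_polys \<and> (\<exists>N. \<forall>n\<ge>N. T n f = f)"
    using assms(4)
  proof (induction rule: fp.span_induct_alt)
    case base
    then show ?case using lie_linear_zero[OF T] lie_polys_closed(1) by blast
  next
    case (step c b g)
    obtain N1 where N1: "\<forall>n\<ge>N1. T n b = b" using assms(3)[OF step(1)] ..
    obtain N2 where N2: "\<forall>n\<ge>N2. T n g = g" using step(2)[THEN conjunct2] ..
    have b: "b \<in> lie_polys" "psmult c b \<in> lie_polys" using B step lie_polys_closed(4) by auto
    then have "T n (psmult c b + g) = psmult c (T n b) + T n g" for n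
      using T[of n] step unfolding lie_linear_def by auto
    then have "T n (psmult c b + g) = psmult c b + g" if "n \<ge> max N1 N2" for n
      using N1 N2 that by simp
    then show ?case using b(2) step(2)[THEN conjunct1] lie_polys_closed(2) by blast
  qed
  then show ?thesis ..
qed

section \<open>Substitutions that fix the y variables\<close>

definition zw_subst :: "(nat \<Rightarrow> 'a::field fpoly) \<Rightarrow> (nat \<Rightarrow> 'a fpoly) \<Rightarrow> var \<Rightarrow> 'a fpoly" where
  "zw_subst g h x = (case x of Y i \<Rightarrow> pvar (Y i) | Z k \<Rightarrow> g k | W k \<Rightarrow> h k)"

definition zw_ok :: "(nat \<Rightarrow> 'a::field fpoly) \<Rightarrow> (nat \<Rightarrow> 'a fpoly) \<Rightarrow> bool" where
  "zw_ok g h \<longleftrightarrow> (\<forall>k. g k \<in> lie_polys \<and> hom 1 (g k) \<and> h k \<in> lie_polys \<and> hom 2 (h k))"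

lemma graded_zw_subst:
  assumes "zw_ok g h"
  shows "graded_subst (zw_subst g h)"
  unfolding graded_subst_iff
proof
  fix x
  show "zw_subst g h x \<in> lie_polys \<and> hom (vdeg x) (zw_subst g h x)"
    using assms
    by (cases x) (auto simp: zw_subst_def zw_ok_def lie_polys_closed hom_pvars)
qed

lemma subst_zw:
  assumes "zw_ok g h"
  shows "subst (zw_subst g h) (adY (pvar (Z k)) xs) = adY (g k) xs"
    "subst (zw_subst g h) (adY (pvar (W k)) xs) = adY (h k) xs"
    "subst (zw_subst g h) (pbr (adY (pvar (Z k)) xs) (adY (pvar (Z l)) ys)) = pbr (adY (g k) xs) (adY (g l) ys)"
proof -
  have \<sigma>: "graded_subst (zw_subst g h)" by (rule graded_zw_subst[OF assms])
  have ad: "subst (zw_subst g h) (adY (pvar x) xs) = adY (zw_subst g h x) xs" for x xs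
    using subst_adY[OF \<sigma> lie_polys.var[of x], of "\<lambda>i. i" xs] graded_subst_fin_supp[OF \<sigma>]
    by (simp add: subst_pvar) (simp add: zw_subst_def)
  show z: "subst (zw_subst g h) (adY (pvar (Z k)) xs) = adY (g k) xs" for k xs
    by (simp add: ad) (simp add: zw_subst_def)
  show "subst (zw_subst g h) (adY (pvar (W k)) xs) = adY (h k) xs"
    by (simp add: ad) (simp add: zw_subst_def)
  show "subst (zw_subst g h) (pbr (adY (pvar (Z k)) xs) (adY (pvar (Z l)) ys)) = pbr (adY (g k) xs) (adY (g l) ys)"
    using graded_subst_fin_supp[OF \<sigma>] by (simp add: subst_pbr z lie_polys_fin_supp adY_lie lie_polys_closed)
qed

lemma span_gens:
  "adY (pvar (Z k)) xs \<in> fp.span (basis_z k)" "adY (pvar (W k)) xs \<in> fp.span (basis_w k)"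
  "pbr (adY (pvar (Z k)) xs) (adY (pvar (Z l)) ys) \<in> fp.span (basis_zz k l)"
  unfolding basis_z_def basis_w_def basis_zz_def by (rule fp.span_base, blast)+

lemma basis2_cases:
  assumes "b \<in> basis2"
  obtains (w) k xs where "b = adY (pvar (W k)) xs"
  | (zz) i xs j ys where "b = pbr (adY (pvar (Z i)) xs) (adY (pvar (Z j)) ys)"
proof -
  from assms consider k where "b \<in> basis_w k" | i j where "b \<in> basis_zz i j"
    unfolding basis2_def by blast
  then show ?thesis
  proof cases
    case 1
    then show ?thesis using w unfolding basis_w_def by blast
  next
    case 2
    then show ?thesis using zz unfolding basis_zz_def by blast
  qed
qed

definition keep :: "(nat \<Rightarrow> var) \<Rightarrow> nat set \<Rightarrow> nat \<Rightarrow> 'a::field fpoly" where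
  "keep V A k = (if k \<in> A then pvar (V k) else 0)"

definition proj :: "nat set \<Rightarrow> nat set \<Rightarrow> 'a::field fpoly \<Rightarrow> 'a fpoly" where
  "proj A B = subst (zw_subst (keep Z A) (keep W B))"

lemma zw_ok_pvars:
  "zw_ok (\<lambda>k. pvar (Z (p k))) (\<lambda>k. pvar (W (q k)))"
  by (simp add: zw_ok_def lie_polys_closed hom_pvars)

lemma zw_ok_keep: "zw_ok (keep Z A) (keep W B)"
  by (simp add: zw_ok_def keep_def lie_polys_closed hom_zero hom_pvars)

lemma proj_basis:
  "proj A B (adY (pvar (Z k)) xs) = (if k \<in> A then adY (pvar (Z k)) xs else 0)"
  "proj A B (adY (pvar (W k)) xs) = (if k \<in> B then adY (pvar (W k)) xs else 0)"
  "proj A B (pbr (adY (pvar (Z k)) xs) (adY (pvar (Z l)) ys)) =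
    (if k \<in> A \<and> l \<in> A then pbr (adY (pvar (Z k)) xs) (adY (pvar (Z l)) ys) else 0)"
  by (simp_all add: proj_def subst_zw[OF zw_ok_keep] keep_def adY_zero pbr_linear)

lemma lie_linear_proj: "lie_linear (proj A B)"
  unfolding proj_def by (rule lie_linear_subst)

lemma (in T_ideal) proj: "f \<in> K \<Longrightarrow> proj A B f \<in> K"
  unfolding proj_def by (intro subst graded_zw_subst zw_ok_keep)

lemma proj_lie: "f \<in> lie_polys \<Longrightarrow> proj A B f \<in> lie_polys"
  unfolding proj_def by (intro subst_lie_polys graded_zw_subst zw_ok_keep)

text \<open>Inclusion and exclusion: on the span of \<open>basis2\<close> and for distinct k and l,
  this extracts the part containing both z_k and z_l.\<close>

definition mixed :: "nat \<Rightarrow> nat \<Rightarrow> 'a::field fpoly \<Rightarrow> 'a fpoly" where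
  "mixed k l f = proj {k, l} {} f - proj {k} {} f - proj {l} {} f"

lemma lie_linear_mixed: "lie_linear (mixed k l)"
  unfolding mixed_def by (intro lie_linear_diff lie_linear_proj)

lemmas mixed_add = lie_linear_mixed[unfolded lie_linear_def, THEN conjunct1, rule_format]

lemma mixed_basis:
  assumes "k \<noteq> l"
  shows "mixed k l (adY (pvar (W j)) xs) = 0"
    "mixed k l (pbr (adY (pvar (Z i)) xs) (adY (pvar (Z j)) ys)) =
      (if (i = k \<and> j = l) \<or> (i = l \<and> j = k) then pbr (adY (pvar (Z i)) xs) (adY (pvar (Z j)) ys) else 0)"
  using assms by (auto simp: mixed_def proj_basis)

text \<open>Here \<open>K\<close> is meant to be the ideal generated by finitely many elements of
  \<open>J\<close>. The assumptions compare \<open>J\<close> and \<open>K\<close> on the model parts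
  in the y's, in z_0, in w_0 and in the pair z_0, z_1; the aim is
  \<open>J \<subseteq> K\<close>.\<close>

locale T_ideal_pair = J: T_ideal J + K: T_ideal K
  for J K :: "'a::field fpoly set" +
  assumes sub: "K \<subseteq> J"
    and two: "(2::'a) \<noteq> 0"
    and y: "f \<in> J \<Longrightarrow> f \<in> fp.span basis0 \<Longrightarrow> f \<in> K"
    and z: "f \<in> J \<Longrightarrow> f \<in> fp.span (basis_z 0) \<Longrightarrow> f \<in> K"
    and w: "f \<in> J \<Longrightarrow> f \<in> fp.span (basis_w 0) \<Longrightarrow> f \<in> K"
    and zz: "f \<in> J \<Longrightarrow> f \<in> fp.span (basis_zz 0 1) \<Longrightarrow> f \<in> K"
begin

text \<open>Substitute into the model variables, use the comparison there, and substitute back; the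
  second substitution inverts the first on \<open>B\<close>, hence on its span.\<close>

lemma zw_subst_transfer:
  assumes \<sigma>: "zw_ok g h" and \<tau>: "zw_ok g' h'"
    and U: "\<And>f. f \<in> J \<Longrightarrow> f \<in> fp.span U \<Longrightarrow> f \<in> K"
    and B: "B \<subseteq> lie_polys" "\<And>b. b \<in> B \<Longrightarrow> subst (zw_subst g h) b \<in> fp.span U"
      "\<And>b. b \<in> B \<Longrightarrow> subst (zw_subst g' h') (subst (zw_subst g h) b) = b"
    and f: "f \<in> J" "f \<in> fp.span B"
  shows "f \<in> K"
proof -
  let ?S = "subst (zw_subst g h)" and ?T = "subst (zw_subst g' h')"
  have "?S f \<in> fp.span U"
    by (rule lie_linear_span[OF lie_linear_subst B(1) fp.subspace_span f(2) B(2)])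
  moreover have "?S f \<in> J" by (intro J.subst f graded_zw_subst \<sigma>)
  ultimately have "?T (?S f) \<in> K" by (intro K.subst graded_zw_subst \<tau> U)
  moreover have "?T (?S f) = f"
  proof (rule lie_linear_eq_on_span[OF _ lie_linear_id B(1) f(2) B(3)])
    show "lie_linear (\<lambda>f. ?T (?S f))"
      by (rule lie_linear_comp[OF lie_linear_subst lie_linear_subst])
        (rule subst_lie_polys[OF graded_zw_subst[OF \<sigma>]])
  qed
  ultimately show ?thesis by simp
qed

lemma mem_z:
  assumes "f \<in> J" "f \<in> fp.span (basis_z k)"
  shows "f \<in> K"
  by (rule zw_subst_transfer[OF zw_ok_pvars[of "\<lambda>_. 0" "\<lambda>k. k"] zw_ok_pvars[of "\<lambda>_. k" "\<lambda>k. k"]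
        z basis_lie(4)[of k] _ _ assms])
    (auto simp: basis_z_def subst_zw[OF zw_ok_pvars] intro!: fp.span_base)

lemma mem_w:
  assumes "f \<in> J" "f \<in> fp.span (basis_w k)"
  shows "f \<in> K"
  by (rule zw_subst_transfer[OF zw_ok_pvars[of "\<lambda>k. k" "\<lambda>_. 0"] zw_ok_pvars[of "\<lambda>k. k" "\<lambda>_. k"]
        w basis_lie(5)[of k] _ _ assms])
    (auto simp: basis_w_def subst_zw[OF zw_ok_pvars] intro!: fp.span_base)

text \<open>The renaming sends k to 0 and every other index to 1. For distinct k and l it is undone
  on \<open>basis_zz k l\<close> by sending 0 to k and every other index to l.\<close>

lemma mem_zz:
  assumes "k \<noteq> l" "f \<in> J" "f \<in> fp.span (basis_zz k l)"
  shows "f \<in> K"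
proof (rule zw_subst_transfer[OF zw_ok_pvars[of "\<lambda>i. if i = k then 0 else 1" "\<lambda>k. k"]
        zw_ok_pvars[of "\<lambda>i. if i = 0 then k else l" "\<lambda>k. k"] zz basis_lie(6)[of k l] _ _ assms(2,3)])
  fix b :: "'a fpoly" assume "b \<in> basis_zz k l"
  then obtain xs ys where b: "b = pbr (adY (pvar (Z k)) xs) (adY (pvar (Z l)) ys)"
    unfolding basis_zz_def by blast
  have S: "subst (zw_subst (\<lambda>i. pvar (Z (if i = k then 0 else 1))) (\<lambda>k. pvar (W k))) b =
      pbr (adY (pvar (Z 0)) xs) (adY (pvar (Z 1)) ys)"
    unfolding b subst_zw(3)[OF zw_ok_pvars] using assms(1) by simp
  then show "subst (zw_subst (\<lambda>i. pvar (Z (if i = k then 0 else 1))) (\<lambda>k. pvar (W k))) b \<in> fp.span (basis_zz 0 1)"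
    by (auto simp only: basis_zz_def intro!: fp.span_base)
  show "subst (zw_subst (\<lambda>i. pvar (Z (if i = 0 then k else l))) (\<lambda>k. pvar (W k)))
      (subst (zw_subst (\<lambda>i. pvar (Z (if i = k then 0 else 1))) (\<lambda>k. pvar (W k))) b) = b"
    unfolding S subst_zw(3)[OF zw_ok_pvars] b by simp
qed

text \<open>An element quadratic in \<open>z\<^sub>k\<close> is recovered, up to the factor 2, from its linearization
  \<open>z\<^sub>k \<mapsto> z\<^sub>0 + z\<^sub>1\<close>.\<close>

lemma mem_zz_diag:
  assumes f: "f \<in> J" "f \<in> fp.span (basis_zz k k)"
  shows "f \<in> K"
proof -
  define S where "S = subst (zw_subst (\<lambda>_. pvar (Z 0) + pvar (Z 1)) (\<lambda>k. pvar (W k)) :: var \<Rightarrow> 'a fpoly)"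
  define R where "R = subst (zw_subst (\<lambda>_. pvar (Z k)) (\<lambda>k. pvar (W k)) :: var \<Rightarrow> 'a fpoly)"
  have ok: "zw_ok (\<lambda>_. pvar (Z 0) + pvar (Z 1) :: 'a fpoly) (\<lambda>k. pvar (W k))"
    by (simp add: zw_ok_def lie_polys_closed hom_add hom_pvars)
  have S: "lie_linear S" "\<And>g. g \<in> lie_polys \<Longrightarrow> S g \<in> lie_polys"
    unfolding S_def by (rule lie_linear_subst, rule subst_lie_polys[OF graded_zw_subst[OF ok]])
  have R: "lie_linear R" unfolding R_def by (rule lie_linear_subst)
  define e where "e = (\<lambda>i j xs ys. pbr (adY (pvar (Z i)) xs) (adY (pvar (Z j)) ys) :: 'a fpoly)"
  have e_lie: "e i j xs ys \<in> lie_polys" for i j xs ys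
    by (simp add: e_def adY_lie lie_polys_closed)
  \<comment> \<open>Of the four terms of the linearization \<open>mixed 0 1\<close> keeps the two
    containing both z_0 and z_1; anticommutativity brings them into the same order.\<close>
  have M: "mixed 0 1 (S (e k k xs ys)) = e 0 1 xs ys - e 0 1 ys xs" for xs ys
  proof -
    have "S (e k k xs ys) = (e 0 0 xs ys + e 1 0 xs ys) + (e 0 1 xs ys + e 1 1 xs ys)"
      by (simp only: S_def e_def subst_zw(3)[OF ok] adY_add pbr_linear(1,2) add.assoc)
    moreover have "mixed 0 1 (e 0 0 xs ys) = 0" "mixed 0 1 (e 1 1 xs ys) = 0"
      "mixed 0 1 (e 1 0 xs ys) = e 1 0 xs ys" "mixed 0 1 (e 0 1 xs ys) = e 0 1 xs ys"
      unfolding e_def by (simp_all add: mixed_basis(2))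
    ultimately have "mixed 0 1 (S (e k k xs ys)) = e 1 0 xs ys + e 0 1 xs ys"
      by (simp only: mixed_add e_lie lie_polys_closed(2) add_0_left add_0_right)
    moreover have "e 1 0 xs ys = - e 0 1 ys xs" unfolding e_def by (rule pbr_anticomm)
    ultimately show ?thesis by simp
  qed
  have lin: "lie_linear (\<lambda>f. mixed 0 1 (S f))" by (rule lie_linear_comp[OF lie_linear_mixed S])
  have "mixed 0 1 (S f) \<in> fp.span (basis_zz 0 1)"
  proof (rule lie_linear_span[OF lin basis_lie(6) fp.subspace_span f(2)])
    fix b :: "'a fpoly" assume "b \<in> basis_zz k k"
    then obtain xs ys where "b = e k k xs ys" unfolding basis_zz_def e_def by blast
    moreover have "e 0 1 xs ys \<in> basis_zz 0 1" for xs ys unfolding basis_zz_def e_def by blast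
    ultimately show "mixed 0 1 (S b) \<in> fp.span (basis_zz 0 1)"
      by (simp only: M) (intro fp.span_diff fp.span_base)
  qed
  moreover have "S f \<in> J" unfolding S_def by (intro J.subst f graded_zw_subst ok)
  then have "mixed 0 1 (S f) \<in> J" unfolding mixed_def by (intro J.closed J.proj)
  ultimately have "mixed 0 1 (S f) \<in> K" by (rule zz[rotated])
  then have "R (mixed 0 1 (S f)) \<in> K"
    unfolding R_def by (intro K.subst graded_zw_subst zw_ok_pvars[of "\<lambda>_. k" "\<lambda>k. k"])
  \<comment> \<open>Identifying z_0 and z_1 with z_k again gives
    \<open>e k k xs ys - e k k ys xs\<close>, which is twice \<open>e k k xs ys\<close> by
    anticommutativity.\<close>
  moreover have "R (mixed 0 1 (S f)) = psmult 2 f"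
  proof (rule lie_linear_eq_on_span[OF _ lie_linear_scale basis_lie(6) f(2)])
    show "lie_linear (\<lambda>f. R (mixed 0 1 (S f)))"
      by (rule lie_linear_comp[OF R lin]) (simp add: mixed_def proj_lie S lie_polys_closed)
    fix b :: "'a fpoly" assume "b \<in> basis_zz k k"
    then obtain xs ys where b: "b = e k k xs ys" unfolding basis_zz_def e_def by blast
    have Re: "R (e i j us vs) = e k k us vs" for i j us vs
      unfolding R_def e_def by (rule subst_zw(3)[OF zw_ok_pvars[of "\<lambda>_. k" "\<lambda>k. k"]])
    have "R (mixed 0 1 (S b)) = e k k xs ys - e k k ys xs"
      unfolding b M using Re by (simp add: R_def subst_diff lie_polys_fin_supp e_lie)
    moreover have "e k k ys xs = - e k k xs ys" unfolding e_def by (rule pbr_anticomm)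
    moreover have "psmult 2 b = e k k xs ys + e k k xs ys"
      using fp.scale_left_distrib[of 1 1 b] by (simp add: b)
    ultimately show "R (mixed 0 1 (S b)) = psmult 2 b" by simp
  qed
  ultimately have "psmult (inverse 2) (psmult 2 f) \<in> K" using K.closed(4) by metis
  then show ?thesis using two by simp
qed

text \<open>\<open>f\<close> is the finite sum of its parts in the single z_k. Each part is a
  projection of \<open>f\<close>, hence in \<open>J\<close>, and \<open>mem_z\<close> applies to
  it.\<close>

lemma mem_basis1:
  assumes f: "f \<in> J" "f \<in> fp.span basis1"
  shows "f \<in> K"
proof -
  define T :: "nat \<Rightarrow> 'a fpoly \<Rightarrow> 'a fpoly" where "T = (\<lambda>n f. \<Sum>k<n. proj {k} UNIV f)"
  have "\<exists>N. \<forall>n\<ge>N. T n f = f"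
  proof (rule lie_linear_eventually_id[OF _ basis_lie(2) _ f(2)])
    show "lie_linear (T n)" for n
      unfolding T_def by (rule lie_linear_sum) (rule lie_linear_proj)
    fix b :: "'a fpoly" assume "b \<in> basis1"
    then obtain k xs where b: "b = adY (pvar (Z k)) xs" by (auto simp: basis1_def basis_z_def)
    show "\<exists>N. \<forall>n\<ge>N. T n b = b"
      by (rule exI[of _ "Suc k"]) (simp add: T_def b proj_basis)
  qed
  then obtain n where n: "T n f = f" by blast
  have "proj {k} UNIV f \<in> K" for k
  proof (rule mem_z)
    show "proj {k} UNIV f \<in> J" by (rule J.proj[OF f(1)])
    show "proj {k} UNIV f \<in> fp.span (basis_z k)"
    proof (rule lie_linear_span[OF lie_linear_proj basis_lie(2) fp.subspace_span f(2)])
      fix b :: "'a fpoly" assume "b \<in> basis1"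
      then obtain l xs where "b = adY (pvar (Z l)) xs" by (auto simp: basis1_def basis_z_def)
      then show "proj {k} UNIV b \<in> fp.span (basis_z k)"
        by (auto simp: proj_basis fp.span_zero span_gens)
    qed
  qed
  then have "T n f \<in> K" unfolding T_def by (intro fp.subspace_sum[OF K.subspace])
  then show ?thesis using n by simp
qed

lemma mem_basis2:
  assumes f: "f \<in> J" "f \<in> fp.span basis2"
  shows "f \<in> K"
proof -
  \<comment> \<open>The three sums collect the parts in a single w_k, the parts quadratic in one
    z_k, and the parts in two distinct variables z_k and z_l.\<close>
  define T :: "nat \<Rightarrow> 'a fpoly \<Rightarrow> 'a fpoly" where
    "T = (\<lambda>n f. (\<Sum>k<n. proj {} {k} f) + (\<Sum>k<n. proj {k} {} f) + (\<Sum>k<n. \<Sum>l<k. mixed k l f))"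
  have "\<exists>N. \<forall>n\<ge>N. T n f = f"
  proof (rule lie_linear_eventually_id[OF _ basis_lie(3) _ f(2)])
    show "lie_linear (T n)" for n
    proof -
      have 1: "lie_linear (\<lambda>f. \<Sum>k<n. proj {} {k} f)" by (rule lie_linear_sum) (rule lie_linear_proj)
      have 2: "lie_linear (\<lambda>f. \<Sum>k<n. proj {k} {} f)" by (rule lie_linear_sum) (rule lie_linear_proj)
      have 3: "lie_linear (\<lambda>f. \<Sum>k<n. \<Sum>l<k. mixed k l f)"
        by (rule lie_linear_sum, rule lie_linear_sum) (rule lie_linear_mixed)
      show ?thesis unfolding T_def by (rule lie_linear_add[OF lie_linear_add[OF 1 2] 3])
    qed
    fix b :: "'a fpoly" assume "b \<in> basis2"
    then show "\<exists>N. \<forall>n\<ge>N. T n b = b"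
    proof (cases rule: basis2_cases)
      case b: (w k xs)
      show ?thesis
        by (rule exI[of _ "Suc k"]) (simp add: T_def b proj_basis mixed_basis)
    next
      case b: (zz i xs j ys)
      \<comment> \<open>As l < k, distinct i and j are met exactly once, at k =
        \<open>max i j\<close> and l = \<open>min i j\<close>; for i = j they are never met.\<close>
      have mix: "mixed k l b = (if l = min i j then if k = max i j then b else 0 else 0)" if "l < k" for k l
        using that unfolding b by (subst mixed_basis) (auto simp: min_def max_def)
      show ?thesis
      proof (rule exI[of _ "Suc (max i j)"], intro allI impI)
        fix n assume n: "Suc (max i j) \<le> n"
        have "(\<Sum>k<n. \<Sum>l<k. mixed k l b) = (\<Sum>k<n. if k = max i j \<and> i \<noteq> j then b else 0)"
        proof (rule sum.cong[OF refl])
          fix k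
          have "(\<Sum>l<k. mixed k l b) = (\<Sum>l<k. if l = min i j then if k = max i j then b else 0 else 0)"
            by (rule sum.cong[OF refl]) (simp add: mix)
          also have "\<dots> = (if k = max i j \<and> i \<noteq> j then b else 0)" by (auto simp: sum.delta)
          finally show "(\<Sum>l<k. mixed k l b) = (if k = max i j \<and> i \<noteq> j then b else 0)" .
        qed
        also have "\<dots> = (if i \<noteq> j then b else 0)" using n by (auto simp: sum.delta)
        finally have 1: "(\<Sum>k<n. \<Sum>l<k. mixed k l b) = (if i \<noteq> j then b else 0)" .
        have "(\<Sum>k<n. proj {k} {} b) = (\<Sum>k<n. if k = i then if i = j then b else 0 else 0)"
          by (rule sum.cong[OF refl]) (auto simp: b proj_basis)
        also have "\<dots> = (if i = j then b else 0)" using n by (auto simp: sum.delta)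
        finally have 2: "(\<Sum>k<n. proj {k} {} b) = (if i = j then b else 0)" .
        have 3: "(\<Sum>k<n. proj {} {k} b) = 0" by (simp add: b proj_basis)
        show "T n b = b" unfolding T_def 1 2 3 by simp
      qed
    qed
  qed
  then obtain n where n: "T n f = f" by blast
  have 1: "proj {} {k} f \<in> K" for k
  proof (rule mem_w)
    show "proj {} {k} f \<in> J" by (rule J.proj[OF f(1)])
    show "proj {} {k} f \<in> fp.span (basis_w k)"
    proof (rule lie_linear_span[OF lie_linear_proj basis_lie(3) fp.subspace_span f(2)])
      fix b :: "'a fpoly" assume "b \<in> basis2"
      then show "proj {} {k} b \<in> fp.span (basis_w k)"
        by (cases rule: basis2_cases) (auto simp: proj_basis fp.span_zero span_gens)
    qed
  qed
  have 2: "proj {k} {} f \<in> K" for k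
  proof (rule mem_zz_diag)
    show "proj {k} {} f \<in> J" by (rule J.proj[OF f(1)])
    show "proj {k} {} f \<in> fp.span (basis_zz k k)"
    proof (rule lie_linear_span[OF lie_linear_proj basis_lie(3) fp.subspace_span f(2)])
      fix b :: "'a fpoly" assume "b \<in> basis2"
      then show "proj {k} {} b \<in> fp.span (basis_zz k k)"
        by (cases rule: basis2_cases) (auto simp: proj_basis fp.span_zero span_gens)
    qed
  qed
  have 3: "mixed k l f \<in> K" if kl: "l < k" for k l
  proof (rule mem_zz)
    show "k \<noteq> l" using kl by simp
    show "mixed k l f \<in> J" unfolding mixed_def by (intro J.closed J.proj f(1))
    show "mixed k l f \<in> fp.span (basis_zz k l)"
    proof (rule lie_linear_span[OF lie_linear_mixed basis_lie(3) fp.subspace_span f(2)])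
      fix b :: "'a fpoly" assume "b \<in> basis2"
      then show "mixed k l b \<in> fp.span (basis_zz k l)"
      proof (cases rule: basis2_cases)
        case (w j xs)
        then show ?thesis using kl by (simp add: mixed_basis fp.span_zero)
      next
        case b: (zz i xs j ys)
        have "pbr (adY (pvar (Z l)) xs) (adY (pvar (Z k)) ys) \<in> fp.span (basis_zz k l)"
          unfolding pbr_anticomm[of "adY (pvar (Z l)) xs"] by (rule fp.span_neg[OF span_gens(3)])
        then show ?thesis using kl span_gens(3) by (auto simp: b mixed_basis fp.span_zero)
      qed
    qed
  qed
  have "T n f \<in> K"
    unfolding T_def by (intro K.closed fp.subspace_sum[OF K.subspace] 1 2 3) simp
  then show ?thesis using n by simp
qed

text \<open>The normal form modulo \<open>K\<close> stays in \<open>J\<close> since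
  \<open>K \<subseteq> J\<close>. Homogeneous components put its three summands into
  \<open>J\<close> one by one, and each degree has its own comparison.\<close>

lemma subset: "J \<subseteq> K"
proof
  fix f assume f: "f \<in> J"
  obtain a b c where abc: "a \<in> fp.span basis0" "b \<in> fp.span basis1" "c \<in> fp.span basis2"
    "f - (a + b + c) \<in> K"
    using K.normal_form[OF J.sub_lie[OF f]] by blast
  have "f - (f - (a + b + c)) = a + b + c" by simp
  then have n: "a + b + c \<in> J" using J.closed(3)[OF f subsetD[OF sub abc(4)]] by (simp only:)
  have hom: "hom 0 a" "hom 1 b" "hom 2 c"
    by (rule hom_span[OF abc(1)], erule hom_basis0) (rule hom_span[OF abc(2)], erule hom_basis1,
      rule hom_span[OF abc(3)], erule hom_basis2)
  have "hcomp 0 (a + b + c) = a" "hcomp 1 (a + b + c) = b" "hcomp 2 (a + b + c) = c"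
    by (simp_all add: hcomp_linear hcomp_hom[OF hom(1)] hcomp_hom[OF hom(2)] hcomp_hom[OF hom(3)])
  then have "a \<in> J" "b \<in> J" "c \<in> J"
    using J.hcomp[OF n, of 0] J.hcomp[OF n, of 1] J.hcomp[OF n, of 2] by simp_all
  then have "a + b + c \<in> K" using abc y mem_basis1 mem_basis2 by (intro K.closed(2)) blast+
  then show "f \<in> K" using abc(4) K.cong_mem by blast
qed

end

text \<open>Sending one y_i with nonzero coefficient to y_0 and all other variables to 0 leaves a
  nonzero multiple of y_0. Together with \<open>span_basis0\<close>, an ideal meets the span of the
  y's in 0 or contains it.\<close>

lemma (in T_ideal) y0_mem:
  assumes f: "f \<in> K" "f \<in> fp.span basis0" "f \<noteq> 0"
  shows "pvar (Y 0) \<in> K"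
proof -
  obtain v where v: "f v \<noteq> 0" using f(3) by (auto simp: fpoly_eq_iff)
  have "\<exists>i. v = [Y i]"
  proof (rule ccontr)
    assume no: "\<nexists>i. v = [Y i]"
    have "f v = 0"
      using f(2)
    proof (induction rule: fp.span_induct_alt)
      case (step c b g)
      then show ?case using no by (auto simp: basis0_def pvar_def psmult_def fpoly_eq_iff)
    qed (simp add: zero_fun_apply)
    with v show False by simp
  qed
  then obtain i where i: "v = [Y i]" by blast
  define \<sigma> :: "var \<Rightarrow> 'a fpoly" where "\<sigma> = (\<lambda>x. if x = Y i then pvar (Y 0) else 0)"
  have \<sigma>: "graded_subst \<sigma>"
    by (simp add: graded_subst_iff \<sigma>_def hom_zero lie_polys_closed hom_pvars)
  have "subst \<sigma> f = psmult (f [Y i]) (pvar (Y 0))"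
  proof (rule lie_linear_eq_on_span[OF lie_linear_subst _ basis_lie(1) f(2)])
    show "lie_linear (\<lambda>f. psmult (f [Y i]) (pvar (Y 0)))"
      by (simp add: lie_linear_def psmult_def fpoly_eq_iff algebra_simps)
    fix b :: "'a fpoly" assume "b \<in> basis0"
    then obtain j where b: "b = pvar (Y j)" by (auto simp: basis0_def)
    have "subst \<sigma> b = \<sigma> (Y j)" unfolding b using graded_subst_fin_supp[OF \<sigma>] by (rule subst_pvar)
    then show "subst \<sigma> b = psmult (b [Y i]) (pvar (Y 0))"
      by (auto simp: \<sigma>_def b pvar_def[of "Y j"])
  qed
  then have "psmult (f [Y i]) (pvar (Y 0)) \<in> K" using subst[OF f(1) \<sigma>] by simp
  from closed(4)[OF this, of "inverse (f [Y i])"] show ?thesis using v i by simp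
qed

lemma (in T_ideal) span_basis0:
  assumes "pvar (Y 0) \<in> K" "f \<in> fp.span basis0"
  shows "f \<in> K"
proof -
  have "basis0 \<subseteq> K"
  proof
    fix b :: "'a fpoly" assume "b \<in> basis0"
    then obtain j where b: "b = pvar (Y j)" by (auto simp: basis0_def)
    define \<sigma> :: "var \<Rightarrow> 'a fpoly" where "\<sigma> = (\<lambda>x. if x = Y 0 then pvar (Y j) else 0)"
    have \<sigma>: "graded_subst \<sigma>"
      by (simp add: graded_subst_iff \<sigma>_def hom_zero lie_polys_closed hom_pvars)
    have "subst \<sigma> (pvar (Y 0)) = \<sigma> (Y 0)" using graded_subst_fin_supp[OF \<sigma>] by (rule subst_pvar)
    then show "b \<in> K" using subst[OF assms(1) \<sigma>] by (simp add: \<sigma>_def b)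
  qed
  then show ?thesis using assms(2) fp.span_minimal[OF _ subspace] by blast
qed

section \<open>The basic identities in UT_3 and the choice of generators\<close>

lemma meval_pbr_pvar:
  assumes "u \<noteq> v"
  shows "meval \<phi> (pbr (pvar u) (pvar v)) i j =
    mmul (\<phi> u) (mmul (\<phi> v) mone) i j - mmul (\<phi> v) (mmul (\<phi> u) mone) i j"
proof -
  have "pbr (pvar u) (pvar v) = (mon [u, v] - mon [v, u] :: 'a fpoly)"
    by (simp add: pbr_conv pvar_conv pmul_mon)
  then have p: "pbr (pvar u) (pvar v) = (\<lambda>w. if w = [u, v] then 1 else if w = [v, u] then - 1 else 0 :: 'a)"
    using assms by (auto simp: fpoly_eq_iff mon_def)
  have "{w. pbr (pvar u) (pvar v) w \<noteq> (0 :: 'a)} = {[u, v], [v, u]}" by (auto simp: p)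
  then show ?thesis using assms by (simp add: meval_def p)
qed

text \<open>Matrices of degree 0 are diagonal and commute; if the degrees add up to more than 2,
  both products would have entries only beyond the last column.\<close>

lemma base_ids_UT3: "base_ids \<subseteq> (UT3_graded_ids :: 'a::field fpoly set)"
proof -
  have "pbr (pvar u) (pvar v) \<in> (UT3_graded_ids :: 'a fpoly set)"
    if "u \<noteq> v" "vdeg u = 0 \<and> vdeg v = 0 \<or> vdeg u + vdeg v > 2" for u v
    unfolding UT3_graded_ids_def
  proof (intro CollectI conjI allI impI ext)
    show "pbr (pvar u) (pvar v) \<in> lie_polys" by (simp add: lie_polys_closed)
    fix \<phi> :: "var \<Rightarrow> 'a mat3" and i j
    assume "\<forall>x. UTdeg (vdeg x) (\<phi> x)"
    then have UT: "\<phi> x a b = 0" if "\<not> (a < 3 \<and> b < 3 \<and> b = a + vdeg x)" for x a b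
      using that unfolding UTdeg_def by blast
    \<comment> \<open>\<open>mone\<close> is a right unit only for matrices whose columns beyond
      index 2 vanish, which the degree condition ensures.\<close>
    have one: "mmul (\<phi> x) mone = \<phi> x" for x
    proof (intro ext)
      fix a b
      show "mmul (\<phi> x) mone a b = \<phi> x a b"
        using UT[of a b x] by (cases "b < 3") (auto simp: mmul_def mone_def if_distrib[of "(*) _"] cong: if_cong)
    qed
    have "mmul (\<phi> u) (\<phi> v) i j = mmul (\<phi> v) (\<phi> u) i j"
      using that(2)
    proof
      assume d: "vdeg u = 0 \<and> vdeg v = 0"
      show ?thesis unfolding mmul_def
      proof (rule sum.cong[OF refl])
        fix k
        show "\<phi> u i k * \<phi> v k j = \<phi> v i k * \<phi> u k j"
        proof (cases "i = k \<and> k = j")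
          case False
          then show ?thesis using UT[of i k] UT[of k j] d by auto
        qed (simp add: mult.commute)
      qed
    next
      assume d: "vdeg u + vdeg v > 2"
      have zero: "\<phi> x i k * \<phi> y k j = 0" if "vdeg x + vdeg y > 2" for x y k
      proof (rule ccontr)
        assume "\<phi> x i k * \<phi> y k j \<noteq> 0"
        then have "k = i + vdeg x" "j = k + vdeg y" "j < 3" using UT[of i k x] UT[of k j y] by auto
        with that show False by linarith
      qed
      show ?thesis
        using zero[OF d] zero[of v u] d unfolding mmul_def by (simp only: add.commute)
    qed
    then show "meval \<phi> (pbr (pvar u) (pvar v)) i j = 0"
      by (simp add: meval_pbr_pvar[OF that(1)] one)
  qed
  then show ?thesis unfolding base_ids_def by auto
qed

text \<open>\<open>J\<close> is one of the intersected ideals, which keeps the intersection inside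
  \<open>lie_polys\<close>; the other closure properties pass to intersections.\<close>

lemma is_TZ3_ideal_generated:
  assumes "is_TZ3_ideal J" "S \<subseteq> J"
  shows "is_TZ3_ideal (TZ3_generated S)" "TZ3_generated S \<subseteq> J" "S \<subseteq> TZ3_generated S"
proof -
  show sub: "TZ3_generated S \<subseteq> J" "S \<subseteq> TZ3_generated S"
    using assms unfolding TZ3_generated_def by blast+
  have "TZ3_generated S \<subseteq> lie_polys"
    using sub(1) assms(1) unfolding is_TZ3_ideal_def by blast
  then show "is_TZ3_ideal (TZ3_generated S)"
    unfolding is_TZ3_ideal_def TZ3_generated_def by simp
qed

theorem mainTheorem6:
  fixes J :: "'a::field fpoly set"
  assumes "infinite (UNIV :: 'a set)"
    and "(2::'a) \<noteq> 0"
    and "is_TZ3_ideal J"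
    and "(UT3_graded_ids :: 'a fpoly set) \<subseteq> J"
  shows "\<exists>S. finite S \<and> S \<subseteq> J \<and> J = TZ3_generated S"
proof -
  have J: "T_ideal J" using assms(3,4) base_ids_UT3 by (auto simp: T_ideal_iff)
  have v: "vdeg (Z 0) \<noteq> 0" "vdeg (W 0) \<noteq> 0" by simp_all
  obtain S1 where S1: "finite S1" "S1 \<subseteq> J" "\<And>K f. T_ideal K \<Longrightarrow> K \<subseteq> J \<Longrightarrow> S1 \<subseteq> K \<Longrightarrow> f \<in> J \<Longrightarrow>
      f \<in> fp.span (range (family1 (Z 0))) \<Longrightarrow> f \<in> K"
    using monomial_family.finite_generation[OF monomial_family1[OF v(1)] J] by blast
  obtain S2 where S2: "finite S2" "S2 \<subseteq> J" "\<And>K f. T_ideal K \<Longrightarrow> K \<subseteq> J \<Longrightarrow> S2 \<subseteq> K \<Longrightarrow> f \<in> J \<Longrightarrow>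
      f \<in> fp.span (range (family1 (W 0))) \<Longrightarrow> f \<in> K"
    using monomial_family.finite_generation[OF monomial_family1[OF v(2)] J] by blast
  obtain S3 where S3: "finite S3" "S3 \<subseteq> J" "\<And>K f. T_ideal K \<Longrightarrow> K \<subseteq> J \<Longrightarrow> S3 \<subseteq> K \<Longrightarrow> f \<in> J \<Longrightarrow>
      f \<in> fp.span (range family2) \<Longrightarrow> f \<in> K"
    using monomial_family.finite_generation[OF monomial_family2 J] by blast
  \<comment> \<open>\<open>base_ids\<close> makes the generated ideal a \<open>T_ideal\<close>;
    \<open>S1\<close>, \<open>S2\<close> and \<open>S3\<close> control the parts in z_0, in w_0 and
    in the pair z_0, z_1. The variable y_0, added if it lies in \<open>J\<close>, settles degree
    0.\<close>
  define S where "S = base_ids \<union> S1 \<union> S2 \<union> S3 \<union> (J \<inter> {pvar (Y 0)})"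
  have fin: "finite S" using S1(1) S2(1) S3(1) by (simp add: S_def base_ids_def)
  have SJ: "S \<subseteq> J" using S1(2) S2(2) S3(2) J by (auto simp: S_def T_ideal_iff)
  define K where "K = TZ3_generated S"
  have K: "is_TZ3_ideal K" "K \<subseteq> J" "S \<subseteq> K"
    unfolding K_def by (rule is_TZ3_ideal_generated[OF assms(3) SJ])+
  then have TK: "T_ideal K" by (auto simp: T_ideal_iff S_def)
  interpret J: T_ideal J by (rule J)
  interpret K: T_ideal K by (rule TK)
  have y: "f \<in> K" if "f \<in> J" "f \<in> fp.span basis0" for f
  proof (cases "f = 0")
    case False
    then have "pvar (Y 0) \<in> K" using J.y0_mem[OF that] K(3) by (auto simp: S_def)
    then show ?thesis using that(2) by (rule K.span_basis0)
  qed (simp add: K.closed)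
  interpret T_ideal_pair J K
  proof
    show "K \<subseteq> J" by fact
    show "(2::'a) \<noteq> 0" by fact
    show "f \<in> K" if "f \<in> J" "f \<in> fp.span basis0" for f using y that .
    show "f \<in> K" if "f \<in> J" "f \<in> fp.span (basis_z 0)" for f
      using S1(3)[OF TK K(2) _ that(1)] that(2) K(3) by (auto simp: S_def basis_z_def range_family1)
    show "f \<in> K" if "f \<in> J" "f \<in> fp.span (basis_w 0)" for f
      using S2(3)[OF TK K(2) _ that(1)] that(2) K(3) by (auto simp: S_def basis_w_def range_family1)
    show "f \<in> K" if "f \<in> J" "f \<in> fp.span (basis_zz 0 1)" for f
      using S3(3)[OF TK K(2) _ that(1)] that(2) K(3) by (auto simp: S_def range_family2)
  qed
  have "J = TZ3_generated S" using subset K(2) by (auto simp: K_def)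
  with fin SJ show ?thesis by blast
qed

end
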